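(* Let $\mathbb{B}$ be a (real) Banach space and let $\mu\ge 0$ be a finite Borel measure on $\mathbb{B}$ concentrated on a $\sigma$-compact set. Then, given any $f\in\mathrm{LIP}_b(\mathbb{B})$ and $\varepsilon>0$, there exists a sequence $(f_n)_n\subseteq\mathrm{Cyl}(\mathbb{B})$, with $\inf_{\mathbb{B}}f\le f_n\le\sup_{\mathbb{B}}f$ on $\mathbb{B}$ for every $n$ and $\sup_n\mathrm{Lip}(f_n)\le\mathrm{Lip}(f)+\varepsilon$, such that $$\lim_n f_n(x)=f(x),\qquad \limsup_n\|\mathrm{d}_x f_n\|_{\mathbb{B}^*}\le\mathrm{lip}_a(f)(x)\qquad\text{for }\mu\text{-a.e. }x\in\mathbb{B}.$$
   Context: For a metric space $(X,d)$, $\mathrm{LIP}_b(X)$ denotes the space of all bounded real-valued Lipschitz functions on $X$. For a real-valued Lipschitz function $f$ on $X$ and a set $A\subseteq X$, $\mathrm{Lip}(f;A)$ denotes the Lipschitz constant of $f$ on $A$, and $\mathrm{Lip}(f):=\mathrm{Lip}(f;X)$. The asymptotic slope $\mathrm{lip}_a(f):X\to[0,\mathrm{Lip}(f)]$ is defined by $\mathrm{lip}_a(f)(x):=\inf_{r>0}\mathrm{Lip}(f;B_r(x))$ for every $x\in X$, where $B_r(x)$ is the open ball of center $x$ and radius $r$. For a Banach space $\mathbb{B}$, $\mathbb{B}^*$ is its dual, $C^\infty(\mathbb{B})$ is the space of smooth (i.e. infinitely Fréchet differentiable) functions $f:\mathbb{B}\to\mathbb{R}$, and $\mathrm{d}_x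 f\in\mathbb{B}^*$ is the Fréchet differential of $f$ at $x$. The space of smooth cylindrical functions $\mathrm{Cyl}(\mathbb{B})$ is the set of all functions of the form $g\circ p:\mathbb{B}\to\mathbb{R}$, where $\mathbb{V}$ is a finite-dimensional Banach space, $p:\mathbb{B}\to\mathbb{V}$ is a bounded linear operator, and $g\in C^\infty(\mathbb{V})\cap\mathrm{LIP}_b(\mathbb{V})$. A set is $\sigma$-compact if it is a countable union of compact sets; $\mu$ is concentrated on a set $E$ if $\mu(\mathbb{B}\setminus E)=0$. *)

theory Defs
  imports "HOL-Analysis.Analysis"
begin

definition sigma_compact :: "'a::topological_space set \<Rightarrow> bool" where
  "sigma_compact E \<longleftrightarrow> (\<exists>\<K>. countable \<K> \<and> (\<forall>K\<in>\<K>. compact K) \<and> E = \<Union>\<K>)"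

definition LIP_b :: "'a::metric_space set \<Rightarrow> ('a \<Rightarrow> real) set" where
  "LIP_b X = {f. bounded (f ` X) \<and> (\<exists>L. L-lipschitz_on X f)}"

text \<open>The least Lipschitz constant; only meaningful when \<open>f\<close> is Lipschitz on \<open>A\<close>.\<close>

definition Lip :: "('a::metric_space \<Rightarrow> real) \<Rightarrow> 'a set \<Rightarrow> real" where
  "Lip f A = Inf {L. L-lipschitz_on A f}"

definition lip_a :: "('a::metric_space \<Rightarrow> real) \<Rightarrow> 'a \<Rightarrow> real" where
  "lip_a f x = (INF r\<in>{0<..}. Lip f (ball x r))"

text \<open>
  Infinite Frechet differentiability of a real-valued function on a linear subspace \<open>V\<close>, regarded
  as a normed space in its own right (values off \<open>V\<close> are irrelevant). The \<open>k\<close>-th differential at \<open>x\<close>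
  is an element of \<open>L(V, L(V, \<dots>, L(V, \<real>)))\<close>, which has no uniform type in \<open>k\<close>; it is identified as
  usual with a bounded \<open>k\<close>-linear form on \<open>V\<close>, the arguments being collected in a list of
  length \<open>k\<close>. The last condition of \<open>C_infinity\<close> says that \<open>D (Suc k) x\<close> is the Frechet differential
  at \<open>x\<close> of \<open>D k\<close> with respect to the operator norm of \<open>k\<close>-linear forms.
\<close>

definition bounded_multilinear_form_on ::
    "'v::real_normed_vector set \<Rightarrow> nat \<Rightarrow> ('v list \<Rightarrow> real) \<Rightarrow> bool" where
  "bounded_multilinear_form_on V k T \<longleftrightarrow>
     (\<forall>vs\<in>lists V. length vs = k \<longrightarrow>
        (\<forall>i<k. \<forall>u\<in>V. \<forall>w\<in>V. \<forall>a b.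
           T (vs[i := a *\<^sub>R u + b *\<^sub>R w]) = a * T (vs[i := u]) + b * T (vs[i := w]))) \<and>
     (\<exists>C. \<forall>vs\<in>lists V. length vs = k \<longrightarrow> \<bar>T vs\<bar> \<le> C * (\<Prod>v\<leftarrow>vs. norm v))"

definition C_infinity :: "'v::real_normed_vector set \<Rightarrow> ('v \<Rightarrow> real) set" where
  "C_infinity V = {g. \<exists>D :: nat \<Rightarrow> 'v \<Rightarrow> 'v list \<Rightarrow> real.
     (\<forall>x\<in>V. D 0 x [] = g x) \<and>
     (\<forall>k. \<forall>x\<in>V. bounded_multilinear_form_on V k (D k x)) \<and>
     (\<forall>k. \<forall>x\<in>V. \<forall>e>0. \<exists>d>0. \<forall>y\<in>V. norm (y - x) < d \<longrightarrow>
        (\<forall>vs\<in>lists V. length vs = k \<longrightarrow>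
           \<bar>D k y vs - D k x vs - D (Suc k) x ((y - x) # vs)\<bar>
             \<le> e * norm (y - x) * (\<Prod>v\<leftarrow>vs. norm v)))}"

text \<open>
  Every finite-dimensional Banach space is isometrically isomorphic to a subspace of the space
  of bounded real sequences, i.e. of the type \<^typ>\<open>nat \<Rightarrow>\<^sub>C real\<close> (\<open>nat\<close> being discrete) with the
  supremum norm. Since transporting \<open>g\<close> and \<open>p\<close> along such an isometry does not change \<open>g \<circ> p\<close>, letting
  \<open>V\<close> range over the finite-dimensional subspaces of this type covers all target spaces.
\<close>

definition Cyl :: "('b::real_normed_vector \<Rightarrow> real) set" where
  "Cyl = {g \<circ> p | (V :: (nat \<Rightarrow>\<^sub>C real) set) g (p :: 'b \<Rightarrow> (nat \<Rightarrow>\<^sub>C real)).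
     (\<exists>S. finite S \<and> V = span S) \<and> bounded_linear p \<and> range p \<subseteq> V \<and> g \<in> C_infinity V \<inter> LIP_b V}"

end

theory Submission imports Defs begin

text \<open>
  A function given by finitely many convex cones \<open>f i + \<psi>\<^sub>i (norm (x - i))\<close>, with \<open>i\<close> in a finite net of a
  compact set, can be localised: if \<open>\<psi>\<^sub>i\<close> has slope slightly above the local Lipschitz constant of \<open>f\<close>
  near \<open>i\<close> up to some small distance and slope \<open>Lip f + \<epsilon>\<close> beyond it, then the minimum over \<open>i\<close>
  agrees with \<open>f\<close> on the net, is \<open>(Lip f + \<epsilon>)\<close>-Lipschitz, and near the compact set only the small
  slopes are visible. By Hahn-Banach, on the net the norm is a maximum of finitely many functionals, so
  this is a minimum of maxima of affine functions of finitely many coordinates. Replacing minimum and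
  maximum by their log-sum-exp versions makes it smooth, with differential a convex combination of
  the slopes in which the inactive ones have exponentially small weight.
\<close>

section \<open>Norming functionals\<close>

text \<open>The differential has to be small in every direction of the space, although
  \<open>f\<close> is controlled only through its values near a compact set. Affine pieces achieve
  this: each slope multiplies a functional of norm at most 1 on the whole space. Only finitely many
  functionals are allowed, and they norm exactly only the differences of net points; at other points
  of the compact set the error is at most the slope times twice the fineness of the net. One slope
  per cone would not do: the local one is too small to keep a distant cone above \<open>f\<close>,
  and the global one would show in the differential near the node. The surplus of both slopes over
  the true Lipschitz constants creates a gap between the cones of far nodes and \<open>f\<close>,
  and the net is chosen fine compared with this gap. The parameter \<open>lam\<close> comes last,
  when the number of pieces is already fixed, so that exponential weights beat it. The bounds by the
  infimum and supremum of \<open>f\<close> are built into the smoothing itself, as a smooth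
  truncation whose derivative is at most 1.\<close>

definition sublinear :: "('a::real_vector \<Rightarrow> real) \<Rightarrow> bool" where
  "sublinear q \<longleftrightarrow> (\<forall>x y. q (x + y) \<le> q x + q y) \<and> (\<forall>t\<ge>0. \<forall>x. q (t *\<^sub>R x) = t * q x)"

lemma sublinearI:
  assumes add: "\<And>x y. q (x + y) \<le> q x + q y"
    and scale: "\<And>t x. t > 0 \<Longrightarrow> q (t *\<^sub>R x) \<le> t * q x" and zero: "q 0 = 0"
  shows "sublinear q"
  unfolding sublinear_def
proof (intro conjI allI impI add)
  fix t :: real and x assume "t \<ge> 0"
  show "q (t *\<^sub>R x) = t * q x"
  proof (cases "t = 0")
    case False
    with \<open>t \<ge> 0\<close> have t: "t > 0" by simp
    have "q ((1 / t) *\<^sub>R t *\<^sub>R x) \<le> 1 / t * q (t *\<^sub>R x)"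
      by (rule scale) (use t in simp)
    then have "t * q x \<le> q (t *\<^sub>R x)" using t by (simp add: field_simps)
    with scale[OF t, of x] show ?thesis by simp
  qed (simp add: zero)
qed

lemma sublinear_add: "sublinear q \<Longrightarrow> q (x + y) \<le> q x + q y"
  and sublinear_scale: "sublinear q \<Longrightarrow> t \<ge> 0 \<Longrightarrow> q (t *\<^sub>R x) = t * q x"
  unfolding sublinear_def by auto

lemma sublinear_zero: "sublinear q \<Longrightarrow> q 0 = 0"
  using sublinear_scale[of q 0] by simp

lemma sublinear_minus: "sublinear q \<Longrightarrow> - q (- x) \<le> q x"
  using sublinear_add[of q x "- x"] sublinear_zero[of q] by simp

text \<open>Letting the argument move along the ray of \<open>y\<close> at price \<open>q y\<close>
  per unit makes the functional odd at \<open>y\<close>: \<open>t = 1\<close> turns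
  \<open>- y\<close> into \<open>0\<close>. The infimum is finite because subadditivity bounds every
  competitor below by \<open>- q (- x)\<close>.\<close>

lemma sublinear_tilt:
  assumes q: "sublinear q"
  obtains p where "sublinear p" "p \<le> q" "p (- y) \<le> - q y"
proof
  define p where "p = (\<lambda>x. INF t\<in>{0..}. q (x + t *\<^sub>R y) - t * q y)"
  have bdd: "bdd_below ((\<lambda>t. q (x + t *\<^sub>R y) - t * q y) ` {0..})" for x
  proof (rule bdd_belowI2)
    fix t :: real assume "t \<in> {0..}"
    then show "- q (- x) \<le> q (x + t *\<^sub>R y) - t * q y"
      using sublinear_add[OF q, of "x + t *\<^sub>R y" "- x"] sublinear_scale[OF q, of t y] by simp
  qed
  have le: "p x \<le> q (x + t *\<^sub>R y) - t * q y" if "t \<ge> 0" for x t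
    unfolding p_def using that by (intro cINF_lower bdd) auto
  have ge: "c \<le> p x" if "\<And>t. t \<ge> 0 \<Longrightarrow> c \<le> q (x + t *\<^sub>R y) - t * q y" for x c
    unfolding p_def using that by (intro cINF_greatest) auto
  show "p \<le> q"
    using le[of 0] by (simp add: le_fun_def)
  show "p (- y) \<le> - q y"
    using le[of 1 "- y"] sublinear_zero[OF q] by simp
  show "sublinear p"
  proof (rule sublinearI)
    fix u v
    have *: "p (u + v) - (q (v + t *\<^sub>R y) - t * q y) \<le> q (u + s *\<^sub>R y) - s * q y"
      if "s \<ge> 0" "t \<ge> 0" for s t
      using le[of "s + t" "u + v"] that sublinear_add[OF q, of "u + s *\<^sub>R y" "v + t *\<^sub>R y"]
      by (simp add: algebra_simps)
    have "p (u + v) - (q (v + t *\<^sub>R y) - t * q y) \<le> p u" if "t \<ge> 0" for t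
      using * that by (intro ge) auto
    then have "p (u + v) - p u \<le> p v"
      by (intro ge) (simp add: algebra_simps)
    then show "p (u + v) \<le> p u + p v" by simp
  next
    fix t :: real and x assume t: "t > 0"
    have "p (t *\<^sub>R x) / t \<le> p x"
    proof (rule ge)
      fix s :: real assume s: "s \<ge> 0"
      have "p (t *\<^sub>R x) \<le> q (t *\<^sub>R (x + s *\<^sub>R y)) - (t * s) * q y"
        using le[of "t * s" "t *\<^sub>R x"] s t by (simp add: algebra_simps)
      also have "\<dots> = t * (q (x + s *\<^sub>R y) - s * q y)"
        using t by (subst sublinear_scale[OF q]) (auto simp: algebra_simps)
      finally show "p (t *\<^sub>R x) / t \<le> q (x + s *\<^sub>R y) - s * q y"
        using t by (simp add: field_simps)
    qed
    then show "p (t *\<^sub>R x) \<le> t * p x" using t by (simp add: field_simps)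
  next
    have "p 0 \<le> 0" using le[of 0 0] sublinear_zero[OF q] by simp
    moreover have "0 \<le> p 0"
      by (rule ge) (simp add: sublinear_scale[OF q])
    ultimately show "p 0 = 0" by simp
  qed
qed

text \<open>An infimum of sublinear functionals is not subadditive in general. In a chain, the
  smaller of two members \<open>p\<close>, \<open>q\<close> serves both summands. The common
  majorant \<open>q0\<close> supplies the lower bound \<open>- q0 (- x)\<close> that keeps the
  infimum finite.\<close>

lemma sublinear_INF:
  assumes "C \<noteq> {}" and sub: "\<And>q. q \<in> C \<Longrightarrow> sublinear q \<and> q \<le> q0"
    and chain: "\<And>p q. p \<in> C \<Longrightarrow> q \<in> C \<Longrightarrow> p \<le> q \<or> q \<le> p"
  defines "u \<equiv> \<lambda>x. INF q\<in>C. q x"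
  shows "sublinear u" and "q \<in> C \<Longrightarrow> u \<le> q"
proof -
  have bdd: "bdd_below ((\<lambda>q. q x) ` C)" for x
  proof (rule bdd_belowI2)
    fix q assume "q \<in> C"
    then show "- q0 (- x) \<le> q x"
      using sublinear_minus[of q x] sub[of q] by (smt (verit) le_funE)
  qed
  have le: "u x \<le> q x" if "q \<in> C" for q x
    unfolding u_def using that by (intro cINF_lower bdd)
  have ge: "c \<le> u x" if "\<And>q. q \<in> C \<Longrightarrow> c \<le> q x" for c x
    unfolding u_def using that \<open>C \<noteq> {}\<close> by (intro cINF_greatest)
  show "q \<in> C \<Longrightarrow> u \<le> q" using le by (simp add: le_fun_def)
  show "sublinear u"
  proof (rule sublinearI)
    fix x y
    have "u (x + y) \<le> p x + q y" if p: "p \<in> C" and q: "q \<in> C" for p q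
    proof -
      obtain r where r: "r \<in> C" "r \<le> p" "r \<le> q" using chain[OF p q] p q by blast
      have "u (x + y) \<le> r x + r y"
        using le[OF r(1), of "x + y"] sublinear_add[of r x y] sub[OF r(1)] by linarith
      also have "\<dots> \<le> p x + q y" using r(2,3) by (intro add_mono) (auto simp: le_fun_def)
      finally show ?thesis .
    qed
    then have "u (x + y) - q y \<le> u x" if "q \<in> C" for q
      using that by (intro ge) (simp add: algebra_simps)
    then have "u (x + y) - u x \<le> u y"
      by (intro ge) (simp add: algebra_simps)
    then show "u (x + y) \<le> u x + u y" by simp
  next
    fix t :: real and x assume t: "t > 0"
    have "u (t *\<^sub>R x) / t \<le> u x"
    proof (rule ge)
      fix q assume "q \<in> C"
      then show "u (t *\<^sub>R x) / t \<le> q x"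
        using le[of q "t *\<^sub>R x"] sublinear_scale[of q t x] sub[of q] t by (simp add: field_simps)
    qed
    then show "u (t *\<^sub>R x) \<le> t * u x" using t by (simp add: field_simps)
  next
    obtain q where "q \<in> C" using \<open>C \<noteq> {}\<close> by blast
    then show "u 0 = 0"
      using le[of q 0] ge[of 0 0] sub sublinear_zero by (metis order.antisym order.refl)
  qed
qed

text \<open>A minimal sublinear functional below \<open>q\<close> cannot be lowered by \<open>sublinear_tilt\<close>, so it is odd.\<close>

lemma sublinear_dominates_linear:
  assumes q0: "sublinear q0"
  obtains l where "linear l" "l \<le> q0"
proof -
  define A where "A = {q. sublinear q \<and> q \<le> q0}"
  \<comment> \<open>Zorn's lemma produces maximal elements, so the pointwise order is reversed to
    obtain a minimal one.\<close>
  have "\<exists>m\<in>A. \<forall>a\<in>A. m \<ge> a \<longrightarrow> a = m"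
  proof (rule predicate_Zorn)
    show "partial_order_on A (relation_of (\<ge>) A)"
      by (rule partial_order_on_relation_ofI) auto
    fix C assume C: "C \<in> Chains (relation_of (\<ge>) A)"
    then have CA: "C \<subseteq> A" and chain: "\<And>p q. p \<in> C \<Longrightarrow> q \<in> C \<Longrightarrow> p \<le> q \<or> q \<le> p"
      unfolding Chains_def relation_of_def by auto
    show "\<exists>u\<in>A. \<forall>a\<in>C. a \<ge> u"
    proof (cases "C = {}")
      case True
      then show ?thesis using q0 by (auto simp: A_def)
    next
      case False
      have sub: "\<And>q. q \<in> C \<Longrightarrow> sublinear q \<and> q \<le> q0" using CA by (auto simp: A_def)
      note u = sublinear_INF[OF False sub chain]
      show ?thesis
      proof (rule bexI, rule ballI)
        show "(\<lambda>x. INF q\<in>C. q x) \<in> A"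
          using u False sub by (auto simp: A_def intro: order.trans)
      qed (rule u(2))
    qed
  qed
  then obtain m where m: "sublinear m" "m \<le> q0" and min: "\<And>a. a \<in> A \<Longrightarrow> a \<le> m \<Longrightarrow> a = m"
    by (auto simp: A_def)
  have odd: "m (- y) = - m y" for y
  proof -
    obtain p where p: "sublinear p" "p \<le> m" "p (- y) \<le> - m y" using sublinear_tilt[OF m(1)] .
    then have "p = m" using m(2) by (intro min) (auto simp: A_def)
    with p(3) sublinear_minus[OF m(1), of y] show ?thesis by simp
  qed
  have "linear m"
  proof (rule linearI)
    fix x y
    \<comment> \<open>Subadditivity at the opposite points, read through oddness, is
      superadditivity.\<close>
    have "m (- x + - y) \<le> m (- x) + m (- y)" by (rule sublinear_add[OF m(1)])
    then have "m x + m y \<le> m (x + y)" using odd[of "x + y"] by (simp add: odd)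
    then show "m (x + y) = m x + m y" using sublinear_add[OF m(1), of x y] by simp
  next
    fix c :: real and x
    show "m (c *\<^sub>R x) = c *\<^sub>R m x"
    proof (cases "c \<ge> 0")
      case False
      then show ?thesis
        using sublinear_scale[OF m(1), of "- c" x] odd[of "c *\<^sub>R x"] by simp
    qed (simp add: sublinear_scale[OF m(1)])
  qed
  with m(2) show ?thesis by (rule that[rotated -1]) 
qed

text \<open>The norm is tilted at \<open>z\<close> before a linear functional is chosen below it:
  then \<open>l (- z) \<le> - norm z\<close>, so every such \<open>l\<close> already attains the
  norm at \<open>z\<close>.\<close>

lemma norming_functional:
  fixes z :: "'a::real_normed_vector"
  obtains l where "bounded_linear l" "\<And>x. \<bar>l x\<bar> \<le> norm x" "l z = norm z"
proof -
  have "sublinear (norm :: 'a \<Rightarrow> real)"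
    by (rule sublinearI) (auto simp: norm_triangle_ineq)
  then obtain p where p: "sublinear p" "p \<le> (norm :: 'a \<Rightarrow> real)" "p (- z) \<le> - norm z"
    by (rule sublinear_tilt)
  obtain l where l: "linear l" "l \<le> p" using sublinear_dominates_linear[OF p(1)] .
  interpret linear l by fact
  have le: "l x \<le> norm x" for x using l(2) p(2) by (meson le_funD order.trans)
  have abs: "\<bar>l x\<bar> \<le> norm x" for x using le[of x] le[of "- x"] by (simp add: neg)
  show ?thesis
  proof (rule that)
    show "bounded_linear l"
      using abs by (intro bounded_linear_intro[of l 1]) (auto simp: add scale)
    show "l z = norm z"
      using le_funD[OF l(2), of "- z"] p(3) le[of z] by (simp add: neg)
  qed (rule abs)
qed

text \<open>Index 0 is reserved for the zero functional. It gives each cone a branch that is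
  constantly the value of \<open>f\<close> at its node, against which steep branches can be
  compared, and it keeps the family nonempty.\<close>

lemma norming_family:
  fixes Z :: "'a::real_normed_vector set"
  assumes "finite Z"
  obtains N :: nat and l :: "nat \<Rightarrow> 'a \<Rightarrow> real"
  where "\<And>k. bounded_linear (l k)" "\<And>k x. \<bar>l k x\<bar> \<le> norm x"
    "\<And>z. z \<in> Z \<Longrightarrow> \<exists>k<N. l k z = norm z" "N > 0" "\<And>x. l 0 x = 0"
proof -
  obtain zs where zs: "set zs = Z" using finite_list[OF assms] by blast
  have "\<forall>z::'a. \<exists>l. bounded_linear l \<and> (\<forall>x. \<bar>l x\<bar> \<le> norm x) \<and> l z = norm z"
    using norming_functional by metis
  from choice[OF this] obtain nf :: "'a \<Rightarrow> 'a \<Rightarrow> real"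
    where nf: "\<And>z. bounded_linear (nf z)" "\<And>z x. \<bar>nf z x\<bar> \<le> norm x" "\<And>z. nf z z = norm z" by blast
  define l where "l k = (case k of 0 \<Rightarrow> (\<lambda>x. 0) | Suc k \<Rightarrow> nf (zs ! k))" for k
  show ?thesis
  proof (rule that[of l "Suc (length zs)"])
    show "bounded_linear (l k)" for k
      by (cases k) (simp_all add: l_def nf(1) bounded_linear_zero)
    show "\<bar>l k x\<bar> \<le> norm x" for k x
      by (cases k) (simp_all add: l_def nf(2))
    fix z assume "z \<in> Z"
    then obtain k where "k < length zs" "zs ! k = z" using zs by (auto simp: in_set_conv_nth)
    then show "\<exists>k<Suc (length zs). l k z = norm z"
      by (intro exI[of _ "Suc k"]) (simp add: l_def nf(3))
  qed (simp_all add: l_def)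
qed

section \<open>Smoothness of elementary functions of finitely many coordinates\<close>

text \<open>The closure rules are chosen so that the class contains the soft minima below and is
  stable under partial derivatives: \<open>ln\<close> brings in \<open>inverse\<close>, and signs
  are handled by constant factors. Smoothness then follows by iterating first derivatives.\<close>

inductive_set elementary :: "nat \<Rightarrow> (nat \<Rightarrow> 'v \<Rightarrow> real) \<Rightarrow> ('v \<Rightarrow> real) set"
  for N :: nat and \<phi> :: "nat \<Rightarrow> 'v \<Rightarrow> real" where
  const: "(\<lambda>x. c) \<in> elementary N \<phi>"
| coord: "j < N \<Longrightarrow> \<phi> j \<in> elementary N \<phi>"
| add: "g \<in> elementary N \<phi> \<Longrightarrow> h \<in> elementary N \<phi> \<Longrightarrow> (\<lambda>x. g x + h x) \<in> elementary N \<phi>"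
| mult: "g \<in> elementary N \<phi> \<Longrightarrow> h \<in> elementary N \<phi> \<Longrightarrow> (\<lambda>x. g x * h x) \<in> elementary N \<phi>"
| exp: "g \<in> elementary N \<phi> \<Longrightarrow> (\<lambda>x. exp (g x)) \<in> elementary N \<phi>"
| inverse: "g \<in> elementary N \<phi> \<Longrightarrow> (\<And>x. g x > 0) \<Longrightarrow> (\<lambda>x. inverse (g x)) \<in> elementary N \<phi>"
| ln: "g \<in> elementary N \<phi> \<Longrightarrow> (\<And>x. g x > 0) \<Longrightarrow> (\<lambda>x. ln (g x)) \<in> elementary N \<phi>"

lemma elementary_sum:
  assumes "\<And>i. i \<in> I \<Longrightarrow> g i \<in> elementary N \<phi>"
  shows "(\<lambda>x. \<Sum>i\<in>I. g i x) \<in> elementary N \<phi>"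
  using assms
proof (induction I rule: infinite_finite_induct)
  case (insert i I)
  have "(\<lambda>x. g i x + (\<Sum>i\<in>I. g i x)) \<in> elementary N \<phi>"
    by (intro elementary.add insert.IH insert.prems) auto
  with insert.hyps show ?case by simp
qed (simp_all add: elementary.const)

definition partials :: "nat \<Rightarrow> (nat \<Rightarrow> 'v \<Rightarrow> real) \<Rightarrow> ('v::real_normed_vector \<Rightarrow> real) \<Rightarrow> (nat \<Rightarrow> 'v \<Rightarrow> real) \<Rightarrow> bool"
  where "partials N \<phi> g g' \<longleftrightarrow> (\<forall>j<N. g' j \<in> elementary N \<phi>) \<and>
    (\<forall>x. (g has_derivative (\<lambda>h. \<Sum>j<N. \<phi> j h * g' j x)) (at x))"

lemma partialsI:
  assumes "\<And>j. j < N \<Longrightarrow> g' j \<in> elementary N \<phi>"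
    and "\<And>x. (g has_derivative D x) (at x)"
    and "\<And>x h. D x h = (\<Sum>j<N. \<phi> j h * g' j x)"
  shows "partials N \<phi> g g'"
  unfolding partials_def
  using assms(1) has_derivative_eq_rhs[OF assms(2) ext[OF assms(3)]] by blast

lemma partialsD:
  assumes "partials N \<phi> g g'"
  shows "j < N \<Longrightarrow> g' j \<in> elementary N \<phi>"
    and "(g has_derivative (\<lambda>h. \<Sum>j<N. \<phi> j h * g' j x)) (at x)"
  using assms by (auto simp: partials_def)

lemma elementary_partials:
  fixes \<phi> :: "nat \<Rightarrow> 'v::real_normed_vector \<Rightarrow> real"
  assumes \<phi>: "\<And>j. j < N \<Longrightarrow> bounded_linear (\<phi> j)" and "g \<in> elementary N \<phi>"
  shows "\<exists>g'. partials N \<phi> g g'"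
  using assms(2)
proof induction
  case (const c)
  show ?case
    by (rule exI, rule partialsI[where g' = "\<lambda>j x. 0", OF elementary.const has_derivative_const]) simp
next
  case (coord i)
  show ?case
  proof (rule exI, rule partialsI[where g' = "\<lambda>j x. if j = i then 1 else 0"])
    show "(\<phi> i has_derivative \<phi> i) (at x)" for x
      by (rule bounded_linear_imp_has_derivative[OF \<phi>[OF coord]])
    show "\<phi> i h = (\<Sum>j<N. \<phi> j h * (if j = i then 1 else 0))" for h
      using coord by (simp add: mult_delta_right)
  qed (rule elementary.const)
next
  case (add g h)
  then obtain g' h' where g: "partials N \<phi> g g'" and h: "partials N \<phi> h h'" by blast
  show ?case
  proof (rule exI, rule partialsI[where g' = "\<lambda>j x. g' j x + h' j x",
          OF _ has_derivative_add[OF partialsD(2)[OF g] partialsD(2)[OF h]]])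
    show "(\<lambda>x. g' j x + h' j x) \<in> elementary N \<phi>" if "j < N" for j
      by (intro elementary.add partialsD(1)[OF g that] partialsD(1)[OF h that])
  qed (simp only: distrib_left sum.distrib)
next
  case (mult g h)
  then obtain g' h' where g: "partials N \<phi> g g'" and h: "partials N \<phi> h h'" by blast
  show ?case
  proof (rule exI, rule partialsI[where g' = "\<lambda>j x. g x * h' j x + g' j x * h x",
          OF _ has_derivative_mult[OF partialsD(2)[OF g] partialsD(2)[OF h]]])
    show "(\<lambda>x. g x * h' j x + g' j x * h x) \<in> elementary N \<phi>" if "j < N" for j
      by (intro elementary.add elementary.mult mult.hyps partialsD(1)[OF g that] partialsD(1)[OF h that])
  qed (simp only: distrib_left sum.distrib sum_distrib_left sum_distrib_right mult.assoc mult.left_commute)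
next
  case (exp g)
  then obtain g' where g: "partials N \<phi> g g'" by blast
  show ?case
  proof (rule exI, rule partialsI[where g' = "\<lambda>j x. exp (g x) * g' j x",
          OF _ has_derivative_exp[OF partialsD(2)[OF g]]])
    show "(\<lambda>x. exp (g x) * g' j x) \<in> elementary N \<phi>" if "j < N" for j
      by (intro elementary.exp elementary.mult exp.hyps partialsD(1)[OF g that])
  qed (simp only: sum_distrib_left sum_distrib_right mult_ac)
next
  case (inverse g)
  then obtain g' where g: "partials N \<phi> g g'" by blast
  have nz: "g x \<noteq> 0" for x using inverse.hyps(2)[of x] by simp
  show ?case
  proof (rule exI, rule partialsI[where g' = "\<lambda>j x. (- 1) * (inverse (g x) * g' j x * inverse (g x))",
          OF _ Deriv.has_derivative_inverse[OF nz partialsD(2)[OF g]]])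
    show "(\<lambda>x. (- 1) * (inverse (g x) * g' j x * inverse (g x))) \<in> elementary N \<phi>" if "j < N" for j
      by (intro elementary.inverse elementary.mult elementary.const inverse.hyps partialsD(1)[OF g that])
  qed (simp only: sum_distrib_left sum_distrib_right sum_negf[symmetric] mult_minus_left mult_minus_right mult_1 mult_ac)
next
  case (ln g)
  then obtain g' where g: "partials N \<phi> g g'" by blast
  show ?case
  proof (rule exI, rule partialsI[where g' = "\<lambda>j x. inverse (g x) * g' j x",
          OF _ has_derivative_ln[OF ln.hyps(2) partialsD(2)[OF g]]])
    show "(\<lambda>x. inverse (g x) * g' j x) \<in> elementary N \<phi>" if "j < N" for j
      by (intro elementary.inverse elementary.mult ln.hyps partialsD(1)[OF g that])
  qed (simp only: sum_distrib_left sum_distrib_right mult_ac)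
qed

text \<open>The coordinates are not assumed linearly independent, so the coefficients of a
  differential are not determined by the function; any choice serves.\<close>

definition elementary_deriv ::
    "nat \<Rightarrow> (nat \<Rightarrow> 'v \<Rightarrow> real) \<Rightarrow> ('v::real_normed_vector \<Rightarrow> real) \<Rightarrow> nat \<Rightarrow> 'v \<Rightarrow> real"
  where "elementary_deriv N \<phi> g = (SOME g'. partials N \<phi> g g')"

text \<open>
  In \<open>C_infinity\<close> a new direction is put in front of the list. Peeling off directions from the
  end instead makes the recursion agree with this without using the symmetry of second derivatives.
\<close>

primrec iterated_deriv ::
    "nat \<Rightarrow> (nat \<Rightarrow> 'v \<Rightarrow> real) \<Rightarrow> nat \<Rightarrow> ('v::real_normed_vector \<Rightarrow> real) \<Rightarrow> 'v \<Rightarrow> 'v list \<Rightarrow> real"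
  where
    "iterated_deriv N \<phi> 0 g x vs = g x"
  | "iterated_deriv N \<phi> (Suc k) g x vs =
      (\<Sum>j<N. \<phi> j (last vs) * iterated_deriv N \<phi> k (elementary_deriv N \<phi> g j) x (butlast vs))"

lemma prod_list_norm_snoc:
  "vs \<noteq> [] \<Longrightarrow> (\<Prod>v\<leftarrow>vs. norm v) = (\<Prod>v\<leftarrow>butlast vs. norm v) * norm (last vs)"
  by (cases vs rule: rev_cases) auto

lemma prod_list_norm_nonneg: "0 \<le> (\<Prod>v\<leftarrow>vs. norm v)"
  by (induction vs) auto

context
  fixes N :: nat and \<phi> :: "nat \<Rightarrow> 'v::real_normed_vector \<Rightarrow> real"
  assumes bl: "\<And>j. j < N \<Longrightarrow> bounded_linear (\<phi> j)"
    and le_norm: "\<And>j v. j < N \<Longrightarrow> \<bar>\<phi> j v\<bar> \<le> norm v"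
begin

lemma partials_elementary_deriv:
  assumes "g \<in> elementary N \<phi>"
  shows "partials N \<phi> g (elementary_deriv N \<phi> g)"
proof -
  have "\<exists>g'. partials N \<phi> g g'"
    by (rule elementary_partials[OF _ assms]) (rule bl)
  then show ?thesis unfolding elementary_deriv_def by (rule someI_ex)
qed

lemma iterated_deriv_update:
  assumes "length vs = k" "i < k"
  shows "iterated_deriv N \<phi> k g x (vs[i := a *\<^sub>R u + b *\<^sub>R w]) =
    a * iterated_deriv N \<phi> k g x (vs[i := u]) + b * iterated_deriv N \<phi> k g x (vs[i := w])"
  using assms
proof (induction k arbitrary: g vs)
  case (Suc k)
  then have ne: "vs \<noteq> []" by auto
  let ?d = "elementary_deriv N \<phi> g"
  show ?case
  proof (cases "i = k")
    case True
    have upd: "iterated_deriv N \<phi> (Suc k) g x (vs[i := z]) =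
        (\<Sum>j<N. \<phi> j z * iterated_deriv N \<phi> k (?d j) x (butlast vs))" for z
      using ne Suc.prems True by (simp add: last_list_update butlast_list_update)
    have "\<phi> j (a *\<^sub>R u + b *\<^sub>R w) = a * \<phi> j u + b * \<phi> j w" if "j < N" for j
      using linear_add[OF bounded_linear.linear[OF bl[OF that]]]
        linear_scale[OF bounded_linear.linear[OF bl[OF that]]] by simp
    then show ?thesis
      unfolding upd sum_distrib_left sum.distrib[symmetric]
      by (intro sum.cong refl) (simp add: distrib_right)
  next
    case False
    then have *: "i < k" "length (butlast vs) = k" using Suc.prems by auto
    have upd: "iterated_deriv N \<phi> (Suc k) g x (vs[i := z]) =
        (\<Sum>j<N. \<phi> j (last vs) * iterated_deriv N \<phi> k (?d j) x ((butlast vs)[i := z]))" for z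
      using ne Suc.prems False by (simp add: last_list_update butlast_list_update)
    show ?thesis
      unfolding upd Suc.IH[OF *(2,1)] sum_distrib_left sum.distrib[symmetric]
      by (intro sum.cong refl) (simp add: distrib_left)
  qed
qed simp

lemma iterated_deriv_bound:
  "\<exists>C\<ge>0. \<forall>vs. length vs = k \<longrightarrow> \<bar>iterated_deriv N \<phi> k g x vs\<bar> \<le> C * (\<Prod>v\<leftarrow>vs. norm v)"
proof (induction k arbitrary: g)
  case 0
  then show ?case by (intro exI[of _ "\<bar>g x\<bar>"]) auto
next
  case (Suc k)
  have "\<forall>j. \<exists>C\<ge>0. \<forall>vs. length vs = k \<longrightarrow>
      \<bar>iterated_deriv N \<phi> k (elementary_deriv N \<phi> g j) x vs\<bar> \<le> C * (\<Prod>v\<leftarrow>vs. norm v)"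
    using Suc.IH by blast
  from choice[OF this] obtain C where C: "\<And>j. C j \<ge> 0" "\<And>j vs. length vs = k \<Longrightarrow>
      \<bar>iterated_deriv N \<phi> k (elementary_deriv N \<phi> g j) x vs\<bar> \<le> C j * (\<Prod>v\<leftarrow>vs. norm v)"
    by blast
  show ?case
  proof (intro exI[of _ "\<Sum>j<N. C j"] conjI allI impI sum_nonneg C(1))
    fix vs :: "'v list" assume len: "length vs = Suc k"
    then have ne: "vs \<noteq> []" by auto
    have "\<bar>iterated_deriv N \<phi> (Suc k) g x vs\<bar> \<le>
        (\<Sum>j<N. \<bar>\<phi> j (last vs) * iterated_deriv N \<phi> k (elementary_deriv N \<phi> g j) x (butlast vs)\<bar>)"
      unfolding iterated_deriv.simps by (rule sum_abs)
    also have "\<dots> \<le> (\<Sum>j<N. norm (last vs) * (C j * (\<Prod>v\<leftarrow>butlast vs. norm v)))"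
      unfolding abs_mult using len
      by (intro sum_mono mult_mono C(2) le_norm) auto
    also have "\<dots> = (\<Sum>j<N. C j) * (\<Prod>v\<leftarrow>vs. norm v)"
      unfolding prod_list_norm_snoc[OF ne] sum_distrib_right by (simp only: mult_ac)
    finally show "\<bar>iterated_deriv N \<phi> (Suc k) g x vs\<bar> \<le> (\<Sum>j<N. C j) * (\<Prod>v\<leftarrow>vs. norm v)" .
  qed
qed

text \<open>The remainder of order \<open>Suc k\<close> is the sum over \<open>j\<close> of
  \<open>\<phi> j (last vs)\<close> times the order \<open>k\<close> remainder of the
  \<open>j\<close>-th partial. The neighbourhood of \<open>x\<close> is chosen before
  \<open>vs\<close>, which is the uniformity that the operator norm demands.\<close>

lemma iterated_deriv_derivative:
  assumes "g \<in> elementary N \<phi>" "e > 0"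
  shows "\<forall>\<^sub>F y in nhds x. \<forall>vs. length vs = k \<longrightarrow>
    \<bar>iterated_deriv N \<phi> k g y vs - iterated_deriv N \<phi> k g x vs
      - iterated_deriv N \<phi> (Suc k) g x ((y - x) # vs)\<bar> \<le> e * norm (y - x) * (\<Prod>v\<leftarrow>vs. norm v)"
  using assms
proof (induction k arbitrary: g e)
  case 0
  then have "(g has_derivative (\<lambda>h. \<Sum>j<N. \<phi> j h * elementary_deriv N \<phi> g j x)) (at x)"
    using partials_elementary_deriv by (simp add: partials_def)
  then show ?case
    using \<open>e > 0\<close> unfolding has_derivative_at_alt eventually_nhds_metric dist_norm by simp
next
  case (Suc k)
  \<comment> \<open>There are \<open>N\<close> summands; the added 1 covers
    \<open>N = 0\<close>.\<close>
  define e' where "e' = e / (real N + 1)"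
  have e': "e' > 0" "real N * e' \<le> e" using Suc.prems by (auto simp: e'_def field_simps)
  let ?d = "elementary_deriv N \<phi> g"
  let ?R = "\<lambda>j y vs. iterated_deriv N \<phi> k (?d j) y vs - iterated_deriv N \<phi> k (?d j) x vs
      - iterated_deriv N \<phi> (Suc k) (?d j) x ((y - x) # vs)"
  have "\<forall>\<^sub>F y in nhds x. \<forall>j\<in>{..<N}. \<forall>vs. length vs = k \<longrightarrow>
      \<bar>?R j y vs\<bar> \<le> e' * norm (y - x) * (\<Prod>v\<leftarrow>vs. norm v)"
  proof (intro eventually_ball_finite ballI)
    fix j assume "j \<in> {..<N}"
    then show "\<forall>\<^sub>F y in nhds x. \<forall>vs. length vs = k \<longrightarrow>
      \<bar>?R j y vs\<bar> \<le> e' * norm (y - x) * (\<Prod>v\<leftarrow>vs. norm v)"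
      using partials_elementary_deriv[OF Suc.prems(1)] e'(1)
      by (intro Suc.IH) (auto simp: partials_def)
  qed simp
  then show ?case
  proof eventually_elim
    case (elim y)
    show ?case
    proof (intro allI impI)
      fix vs :: "'v list" assume len: "length vs = Suc k"
      then have ne: "vs \<noteq> []" and len': "length (butlast vs) = k" by auto
      have 1: "iterated_deriv N \<phi> (Suc k) g z vs
          = (\<Sum>j<N. \<phi> j (last vs) * iterated_deriv N \<phi> k (?d j) z (butlast vs))" for z
        by (rule iterated_deriv.simps(2))
      have 2: "iterated_deriv N \<phi> (Suc (Suc k)) g x (h # vs)
          = (\<Sum>j<N. \<phi> j (last vs) * iterated_deriv N \<phi> (Suc k) (?d j) x (h # butlast vs))" for h
        using ne by (subst iterated_deriv.simps(2)) (simp only: last.simps butlast.simps if_False)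
      have eq: "iterated_deriv N \<phi> (Suc k) g y vs - iterated_deriv N \<phi> (Suc k) g x vs
          - iterated_deriv N \<phi> (Suc (Suc k)) g x ((y - x) # vs)
        = (\<Sum>j<N. \<phi> j (last vs) * ?R j y (butlast vs))"
        unfolding 1 2 by (simp only: sum_subtractf right_diff_distrib)
      have "\<bar>iterated_deriv N \<phi> (Suc k) g y vs - iterated_deriv N \<phi> (Suc k) g x vs
          - iterated_deriv N \<phi> (Suc (Suc k)) g x ((y - x) # vs)\<bar>
        \<le> (\<Sum>j<N. \<bar>\<phi> j (last vs) * ?R j y (butlast vs)\<bar>)"
        unfolding eq by (rule sum_abs)
      also have "\<dots> \<le> (\<Sum>j<N. norm (last vs) * (e' * norm (y - x) * (\<Prod>v\<leftarrow>butlast vs. norm v)))"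
        unfolding abs_mult
        by (intro sum_mono mult_mono le_norm elim[rule_format, OF _ len'] norm_ge_zero abs_ge_zero) simp_all
      also have "\<dots> = (real N * e') * norm (y - x) * (\<Prod>v\<leftarrow>vs. norm v)"
        unfolding prod_list_norm_snoc[OF ne] by (simp only: sum_constant card_lessThan mult_ac)
      also have "\<dots> \<le> e * norm (y - x) * (\<Prod>v\<leftarrow>vs. norm v)"
        using e'(2) by (intro mult_right_mono) (auto simp: prod_list_norm_nonneg)
      finally show "\<bar>iterated_deriv N \<phi> (Suc k) g y vs - iterated_deriv N \<phi> (Suc k) g x vs
          - iterated_deriv N \<phi> (Suc (Suc k)) g x ((y - x) # vs)\<bar>
          \<le> e * norm (y - x) * (\<Prod>v\<leftarrow>vs. norm v)" .
    qed
  qed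
qed

lemma elementary_C_infinity:
  assumes "g \<in> elementary N \<phi>"
  shows "g \<in> C_infinity V"
proof -
  have "bounded_multilinear_form_on V k (iterated_deriv N \<phi> k g x)" for k x
    unfolding bounded_multilinear_form_on_def
    using iterated_deriv_bound[where k = k and g = g and x = x] iterated_deriv_update by blast
  moreover have "\<exists>d>0. \<forall>y\<in>V. norm (y - x) < d \<longrightarrow> (\<forall>vs\<in>lists V. length vs = k \<longrightarrow>
      \<bar>iterated_deriv N \<phi> k g y vs - iterated_deriv N \<phi> k g x vs
        - iterated_deriv N \<phi> (Suc k) g x ((y - x) # vs)\<bar> \<le> e * norm (y - x) * (\<Prod>v\<leftarrow>vs. norm v))"
    if "e > 0" for k x e
    using iterated_deriv_derivative[OF assms that, where x = x and k = k]
    unfolding eventually_nhds_metric dist_norm by blast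
  ultimately show ?thesis
    unfolding C_infinity_def
    by (intro CollectI exI[of _ "\<lambda>k. iterated_deriv N \<phi> k g"] conjI allI ballI impI)
      (simp_all only: iterated_deriv.simps(1))
qed

end

section \<open>Soft minima of soft maxima\<close>

definition exp_sum :: "real \<Rightarrow> 'j set \<Rightarrow> ('j \<Rightarrow> 'v \<Rightarrow> real) \<Rightarrow> 'v \<Rightarrow> real" where
  "exp_sum lam J A x = (\<Sum>j\<in>J. exp (lam * A j x))"

text \<open>The soft maximum is \<open>ln T / lam\<close> with \<open>T\<close> the exponential sum,
  so the exponential of \<open>- lam\<close> times it is just \<open>inverse T\<close>, and no inner
  logarithm appears. Working with this sum rather than its logarithm also allows an empty
  \<open>I\<close>, where \<open>soft_minmax\<close> becomes \<open>M\<close>.\<close>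

definition inverse_exp_sum ::
    "real \<Rightarrow> 'i set \<Rightarrow> 'j set \<Rightarrow> ('i \<Rightarrow> 'j \<Rightarrow> 'v \<Rightarrow> real) \<Rightarrow> 'v \<Rightarrow> real" where
  "inverse_exp_sum lam I J A x = (\<Sum>i\<in>I. inverse (exp_sum lam J (A i) x))"

text \<open>
  A smooth version of \<open>min M (max m (MIN i\<in>I. MAX j\<in>J. A i j x))\<close> with values in \<open>[m, M]\<close>: with
  \<open>t = - ln S / lam\<close> being the soft minimum of the soft maxima, it equals
  \<open>m + ln ((1 + exp (lam * (t - m))) / (1 + exp (lam * (t - M)))) / lam\<close>.
\<close>

definition soft_minmax ::
    "real \<Rightarrow> real \<Rightarrow> real \<Rightarrow> 'i set \<Rightarrow> 'j set \<Rightarrow> ('i \<Rightarrow> 'j \<Rightarrow> 'v \<Rightarrow> real) \<Rightarrow> 'v \<Rightarrow> real" where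
  "soft_minmax lam m M I J A x = m + (ln (inverse_exp_sum lam I J A x + exp (- lam * m))
    - ln (inverse_exp_sum lam I J A x + exp (- lam * M))) / lam"

lemma ln_mult_exp: "u > 0 \<Longrightarrow> ln (u * exp v) = ln u + v" for u v :: real
  by (simp add: ln_mult)

context
  fixes lam m M :: real and I :: "'i set" and J :: "'j set"
    and A :: "'i \<Rightarrow> 'j \<Rightarrow> 'v::real_normed_vector \<Rightarrow> real"
  assumes lam: "lam > 0" and mM: "m \<le> M" and I: "finite I" and J: "finite J" "J \<noteq> {}"
begin

private abbreviation "T i x \<equiv> exp_sum lam J (A i) x"
private abbreviation "S x \<equiv> inverse_exp_sum lam I J A x"

lemma exp_sum_pos: "T i x > 0"
  unfolding exp_sum_def using J by (intro sum_pos) auto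

lemma inverse_exp_sum_nonneg: "S x \<ge> 0"
  unfolding inverse_exp_sum_def by (intro sum_nonneg) (simp add: exp_sum_pos less_imp_le)

text \<open>For \<open>0 < b \<le> a\<close> and \<open>S \<ge> 0\<close> the quotient
  \<open>(S + a) / (S + b)\<close> lies between \<open>1\<close> and \<open>a / b\<close>, here
  \<open>exp (lam * (M - m))\<close>. This gives both this bound and the next.\<close>

lemma soft_minmax_ge: "m \<le> soft_minmax lam m M I J A x"
proof -
  have "exp (- lam * M) \<le> exp (- lam * m)" using lam mM by simp
  then have "ln (S x + exp (- lam * M)) \<le> ln (S x + exp (- lam * m))"
    using inverse_exp_sum_nonneg[of x] by (intro ln_mono) (auto simp: add_nonneg_pos)
  then show ?thesis using lam by (simp add: soft_minmax_def)
qed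

lemma soft_minmax_le: "soft_minmax lam m M I J A x \<le> M"
proof -
  have le: "exp (- lam * M) \<le> exp (- lam * m)" using lam mM by simp
  have "S x * exp (- lam * M) \<le> S x * exp (- lam * m)"
    by (intro mult_left_mono le inverse_exp_sum_nonneg)
  then have "(S x + exp (- lam * m)) * exp (- lam * M) \<le> (S x + exp (- lam * M)) * exp (- lam * m)"
    by (simp only: distrib_right mult.commute[of "exp (- lam * m)"] add_le_cancel_right)
  then have "ln ((S x + exp (- lam * m)) * exp (- lam * M)) \<le> ln ((S x + exp (- lam * M)) * exp (- lam * m))"
    using inverse_exp_sum_nonneg[of x] by (intro ln_mono) (auto simp: add_nonneg_pos)
  then have "ln (S x + exp (- lam * m)) - ln (S x + exp (- lam * M)) \<le> lam * (M - m)"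
    using inverse_exp_sum_nonneg[of x] by (simp add: ln_mult_exp add_nonneg_pos right_diff_distrib)
  then have "(ln (S x + exp (- lam * m)) - ln (S x + exp (- lam * M))) / lam \<le> M - m"
    using lam by (simp add: divide_le_eq mult.commute)
  then show ?thesis by (simp add: soft_minmax_def)
qed

text \<open>The truncation at \<open>M\<close> acts like one more competitor in the minimum, hence
  \<open>card I + 1\<close>.\<close>

lemma soft_minmax_lower:
  assumes t: "t \<le> M" and "\<kappa> \<ge> 0" and T: "\<And>i. i \<in> I \<Longrightarrow> exp (lam * (t - \<kappa>)) \<le> T i x"
  shows "t - \<kappa> - ln (real (card I) + 1) / lam \<le> soft_minmax lam m M I J A x"
proof -
  have "S x \<le> (\<Sum>i\<in>I. inverse (exp (lam * (t - \<kappa>))))"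
    unfolding inverse_exp_sum_def by (intro sum_mono le_imp_inverse_le T) auto
  then have "S x \<le> real (card I) * exp (- lam * (t - \<kappa>))"
    by (simp add: exp_minus)
  moreover have "exp (- lam * M) \<le> exp (- lam * (t - \<kappa>))"
    using t \<open>\<kappa> \<ge> 0\<close> lam by simp
  ultimately have "S x + exp (- lam * M) \<le> (real (card I) + 1) * exp (- lam * (t - \<kappa>))"
    by (subst distrib_right) linarith
  then have "ln (S x + exp (- lam * M)) \<le> ln ((real (card I) + 1) * exp (- lam * (t - \<kappa>)))"
    using inverse_exp_sum_nonneg[of x] by (intro ln_mono) (auto simp: add_nonneg_pos)
  then have 1: "ln (S x + exp (- lam * M)) \<le> ln (real (card I) + 1) - lam * (t - \<kappa>)"
    by (simp add: ln_mult)
  have "ln (exp (- lam * m)) \<le> ln (S x + exp (- lam * m))"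
    using inverse_exp_sum_nonneg[of x] by (intro ln_mono) auto
  with 1 have "lam * (t - \<kappa> - m) - ln (real (card I) + 1)
      \<le> ln (S x + exp (- lam * m)) - ln (S x + exp (- lam * M))"
    by (simp add: algebra_simps)
  from divide_right_mono[OF this, of lam] lam show ?thesis
    by (simp add: soft_minmax_def diff_divide_distrib)
qed

lemma inverse_exp_sum_ge:
  assumes "i \<in> I" "T i x \<le> P * exp (lam * s)" "P > 0"
  shows "exp (- lam * s) / P \<le> S x"
proof -
  have "exp (- lam * s) / P = inverse (P * exp (lam * s))"
    by (simp add: exp_minus divide_inverse)
  also have "\<dots> \<le> inverse (T i x)"
    using assms exp_sum_pos by (intro le_imp_inverse_le)
  also have "\<dots> \<le> S x"
    unfolding inverse_exp_sum_def using I assms(1) exp_sum_pos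
    by (intro member_le_sum) (auto simp: less_imp_le)
  finally show ?thesis .
qed

text \<open>For an upper bound on a minimum one good index suffices. \<open>P\<close> stands for the
  number of branches in the soft maximum; the added 1 comes from the truncation at
  \<open>m\<close>.\<close>

lemma soft_minmax_upper:
  assumes t: "m \<le> t" and "\<kappa> \<ge> 0" and i: "i \<in> I" "T i x \<le> P * exp (lam * (t + \<kappa>))" "P > 0"
  shows "soft_minmax lam m M I J A x \<le> t + \<kappa> + ln (P + 1) / lam"
proof -
  let ?s = "lam * (t + \<kappa> - m)"
  from inverse_exp_sum_ge[OF i] have S: "exp (- lam * (t + \<kappa>)) \<le> P * S x"
    using \<open>P > 0\<close> by (simp add: field_simps)
  have Spos: "S x > 0"
    using inverse_exp_sum_ge[OF i] \<open>P > 0\<close> by (smt (verit) divide_pos_pos exp_gt_zero)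
  have "exp (- lam * m) = exp ?s * exp (- lam * (t + \<kappa>))"
    by (simp flip: exp_add add: algebra_simps)
  also have "\<dots> \<le> exp ?s * (P * S x)"
    by (intro mult_left_mono S) auto
  finally have "exp (- lam * m) \<le> exp ?s * (P * S x)" .
  moreover have "1 \<le> exp ?s" using t \<open>\<kappa> \<ge> 0\<close> lam by simp
  then have "1 * S x \<le> exp ?s * S x"
    by (intro mult_right_mono inverse_exp_sum_nonneg)
  ultimately have "S x + exp (- lam * m) \<le> exp ?s * S x + exp ?s * (P * S x)"
    by linarith
  also have "\<dots> = (P + 1) * exp ?s * S x"
    unfolding distrib_right by (simp only: mult_ac add_ac mult_1)
  finally have "S x + exp (- lam * m) \<le> (P + 1) * exp ?s * S x" .
  then have "ln (S x + exp (- lam * m)) \<le> ln ((P + 1) * exp ?s * S x)"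
    using Spos by (intro ln_mono) (auto simp: add_pos_pos)
  also have "\<dots> = ln (P + 1) + ?s + ln (S x)"
    using Spos \<open>P > 0\<close> by (simp add: ln_mult)
  finally have "ln (S x + exp (- lam * m)) \<le> ln (P + 1) + ?s + ln (S x)" .
  moreover have "ln (S x) \<le> ln (S x + exp (- lam * M))"
    using Spos by (intro ln_mono) auto
  ultimately have "ln (S x + exp (- lam * m)) - ln (S x + exp (- lam * M)) \<le> ln (P + 1) + ?s"
    by simp
  from divide_right_mono[OF this, of lam] lam show ?thesis
    by (simp add: soft_minmax_def add_divide_distrib)
qed

text \<open>The factor \<open>lam\<close> from the exponents cancels against the division by
  \<open>lam\<close>, so bounds on the slopes pass to the differential uniformly in
  \<open>lam\<close>.\<close>

lemma soft_minmax_derivative: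
  assumes A': "\<And>i j. i \<in> I \<Longrightarrow> j \<in> J \<Longrightarrow> (A i j has_derivative A' i j) (at x)"
  shows "(soft_minmax lam m M I J A has_derivative (\<lambda>h.
    (\<Sum>i\<in>I. inverse (T i x) * (\<Sum>j\<in>J. exp (lam * A i j x) / T i x * A' i j h)) *
    ((exp (- lam * m) - exp (- lam * M)) / ((S x + exp (- lam * m)) * (S x + exp (- lam * M)))))) (at x)"
proof -
  define D where "D h = (\<Sum>i\<in>I. inverse (T i x) * (\<Sum>j\<in>J. exp (lam * A i j x) / T i x * A' i j h))" for h
  define a b where "a = exp (- lam * m)" and "b = exp (- lam * M)"
  have T': "((\<lambda>x. T i x) has_derivative (\<lambda>h. \<Sum>j\<in>J. lam * A' i j h * exp (lam * A i j x))) (at x)"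
    if "i \<in> I" for i
    unfolding exp_sum_def
    by (intro has_derivative_sum has_derivative_exp has_derivative_mult_right A' that)
  have "((\<lambda>x. S x) has_derivative (\<lambda>h. \<Sum>i\<in>I. - (inverse (T i x) *
      (\<Sum>j\<in>J. lam * A' i j h * exp (lam * A i j x)) * inverse (T i x)))) (at x)"
    unfolding inverse_exp_sum_def
    by (intro has_derivative_sum Deriv.has_derivative_inverse T' less_imp_neq[THEN not_sym] exp_sum_pos)
  also have "(\<lambda>h. \<Sum>i\<in>I. - (inverse (T i x) *
      (\<Sum>j\<in>J. lam * A' i j h * exp (lam * A i j x)) * inverse (T i x))) = (\<lambda>h. - lam * D h)"
    unfolding D_def sum_distrib_left sum_distrib_right sum_negf[symmetric]
    by (intro ext sum.cong refl) (simp add: divide_inverse)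
  finally have S': "((\<lambda>x. S x) has_derivative (\<lambda>h. - lam * D h)) (at x)" .
  have pos: "S x + a > 0" "S x + b > 0"
    using inverse_exp_sum_nonneg[of x] by (auto simp: a_def b_def add_nonneg_pos)
  have *: "0 + ((- lam * d + 0) * inverse u - (- lam * d + 0) * inverse v) / lam = d * ((u - v) / (u * v))"
    if "u > 0" "v > 0" for d u v
    using that lam by (simp add: field_simps)
  have "((\<lambda>x. m + (ln (S x + a) - ln (S x + b)) / lam) has_derivative
     (\<lambda>h. 0 + ((- lam * D h + 0) * inverse (S x + a) - (- lam * D h + 0) * inverse (S x + b)) / lam)) (at x)"
    using lam by (intro has_derivative_add has_derivative_const bounded_linear.has_derivative[OF bounded_linear_divide]
        has_derivative_diff has_derivative_ln S' pos)
  also have "(\<lambda>h. 0 + ((- lam * D h + 0) * inverse (S x + a) - (- lam * D h + 0) * inverse (S x + b)) / lam)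
      = (\<lambda>h. D h * ((a - b) / ((S x + a) * (S x + b))))"
    using lam pos *[of "S x + a" "S x + b"] by simp
  finally show ?thesis
    unfolding D_def a_def b_def soft_minmax_def[abs_def] .
qed

text \<open>The differential is a combination of the \<open>A' i j\<close> with nonnegative weights
  of total at most 1. An index either has average slope at most \<open>R\<close>, or carries
  relative weight at most \<open>\<theta>\<close> and slopes at most \<open>L\<close>; there are at
  most \<open>card I\<close> of the second kind.\<close>

lemma soft_minmax_derivative_bound:
  assumes A': "\<And>i j. i \<in> I \<Longrightarrow> j \<in> J \<Longrightarrow> (A i j has_derivative A' i j) (at x)"
    and c: "\<And>i j h. i \<in> I \<Longrightarrow> j \<in> J \<Longrightarrow> \<bar>A' i j h\<bar> \<le> c i j * norm h"
    and nonneg: "R \<ge> 0" "\<theta> \<ge> 0" "L \<ge> 0"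
    and cases: "\<And>i. i \<in> I \<Longrightarrow> (\<Sum>j\<in>J. exp (lam * A i j x) / T i x * c i j) \<le> R \<or>
      inverse (T i x) \<le> \<theta> * S x \<and> (\<forall>j\<in>J. c i j \<le> L)"
  obtains D where "(soft_minmax lam m M I J A has_derivative D) (at x)"
    "onorm D \<le> R + real (card I) * \<theta> * L"
proof -
  define a b where "a = exp (- lam * m)" and "b = exp (- lam * M)"
  define Q where "Q = (a - b) / ((S x + a) * (S x + b))"
  define E where "E h = (\<Sum>i\<in>I. inverse (T i x) * (\<Sum>j\<in>J. exp (lam * A i j x) / T i x * A' i j h))" for h
  have ab: "b \<le> a" "b > 0" using lam mM by (auto simp: a_def b_def)
  have S: "S x \<ge> 0" by (rule inverse_exp_sum_nonneg)
  have Q: "Q \<ge> 0" using ab S by (simp add: Q_def)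
  \<comment> \<open>This product is \<open>a / (S x + a) - b / (S x + b)\<close>, the derivative of
    the truncation with respect to the soft minimum.\<close>
  have SQ: "S x * Q \<le> 1"
  proof -
    have "S x * (a - b) \<le> (S x + a) * (S x + b)"
      using ab S mult_nonneg_nonneg[of "S x" b] mult_nonneg_nonneg[of "S x" "S x"] mult_nonneg_nonneg[of a b]
      by (simp add: algebra_simps)
    moreover have "(S x + a) * (S x + b) > 0" using ab S by (intro mult_pos_pos) auto
    ultimately show ?thesis by (simp add: Q_def divide_le_eq)
  qed
  let ?C = "R + real (card I) * \<theta> * L"
  have C: "?C \<ge> 0" using nonneg by simp
  have weights: "(\<Sum>j\<in>J. exp (lam * A i j x) / T i x) = 1" for i
    using exp_sum_pos[of i x] by (simp add: sum_divide_distrib[symmetric] exp_sum_def)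
  have E: "\<bar>E h\<bar> \<le> S x * ?C * norm h" for h
  proof -
    have "\<bar>E h\<bar> \<le> (\<Sum>i\<in>I. \<bar>inverse (T i x) * (\<Sum>j\<in>J. exp (lam * A i j x) / T i x * A' i j h)\<bar>)"
      unfolding E_def by (rule sum_abs)
    also have "\<dots> \<le> (\<Sum>i\<in>I. (inverse (T i x) * R + \<theta> * S x * L) * norm h)"
    proof (rule sum_mono)
      fix i assume i: "i \<in> I"
      let ?t = "inverse (T i x)" and ?s = "\<Sum>j\<in>J. exp (lam * A i j x) / T i x * c i j"
      have t: "?t > 0" using exp_sum_pos by simp
      have "\<bar>\<Sum>j\<in>J. exp (lam * A i j x) / T i x * A' i j h\<bar>
          \<le> (\<Sum>j\<in>J. \<bar>exp (lam * A i j x) / T i x * A' i j h\<bar>)" by (rule sum_abs)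
      also have "\<dots> \<le> (\<Sum>j\<in>J. exp (lam * A i j x) / T i x * (c i j * norm h))"
        unfolding abs_mult using exp_sum_pos[of i x]
        by (intro sum_mono mult_mono c i) (auto simp: less_imp_le)
      also have "\<dots> = ?s * norm h" by (simp add: sum_distrib_right mult.assoc)
      finally have *: "\<bar>inverse (T i x) * (\<Sum>j\<in>J. exp (lam * A i j x) / T i x * A' i j h)\<bar> \<le> ?t * ?s * norm h"
        using t by (simp add: abs_mult mult.assoc)
      have "?t * ?s \<le> ?t * R + \<theta> * S x * L"
        using cases[OF i]
      proof
        assume "?s \<le> R"
        then have "?t * ?s \<le> ?t * R" using t by simp
        then show ?thesis using nonneg S by (simp add: add_increasing2)
      next
        assume far: "?t \<le> \<theta> * S x \<and> (\<forall>j\<in>J. c i j \<le> L)"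
        have "?s \<le> (\<Sum>j\<in>J. exp (lam * A i j x) / T i x * L)"
          using far exp_sum_pos[of i x] by (intro sum_mono mult_left_mono) (auto simp: less_imp_le)
        also have "\<dots> = L" by (simp only: sum_distrib_right[symmetric] weights mult_1)
        finally have "?t * ?s \<le> ?t * L" using t by simp
        also have "\<dots> \<le> \<theta> * S x * L" using far nonneg by (intro mult_right_mono) auto
        finally show ?thesis using t nonneg by (simp add: add_increasing)
      qed
      then have "?t * ?s * norm h \<le> (?t * R + \<theta> * S x * L) * norm h"
        by (rule mult_right_mono) simp
      with * show "\<bar>inverse (T i x) * (\<Sum>j\<in>J. exp (lam * A i j x) / T i x * A' i j h)\<bar>
          \<le> (?t * R + \<theta> * S x * L) * norm h" by linarith
    qed
    also have "\<dots> = S x * ?C * norm h"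
      unfolding sum_distrib_right[symmetric] sum.distrib
      by (simp add: inverse_exp_sum_def distrib_left distrib_right mult_ac)
    finally show ?thesis .
  qed
  show ?thesis
  proof (rule that)
    show "(soft_minmax lam m M I J A has_derivative (\<lambda>h. E h * Q)) (at x)"
      using soft_minmax_derivative[OF A'] unfolding E_def Q_def a_def b_def by simp
    show "onorm (\<lambda>h. E h * Q) \<le> ?C"
    proof (rule onorm_bound[OF C])
      fix h
      have "norm (E h * Q) \<le> S x * ?C * norm h * Q"
        using E[of h] Q by (simp add: abs_mult mult_right_mono)
      also have "\<dots> = (S x * Q) * (?C * norm h)" by simp
      also have "\<dots> \<le> 1 * (?C * norm h)" using SQ C by (intro mult_right_mono) auto
      finally show "norm (E h * Q) \<le> ?C * norm h" by simp
    qed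
  qed
qed

text \<open>Here every index is of the first kind, with \<open>R = L\<close>; the mean value
  inequality does the rest.\<close>

lemma soft_minmax_lipschitz:
  assumes A': "\<And>i j x. i \<in> I \<Longrightarrow> j \<in> J \<Longrightarrow> (A i j has_derivative A' i j) (at x)"
    and c: "\<And>i j h. i \<in> I \<Longrightarrow> j \<in> J \<Longrightarrow> \<bar>A' i j h\<bar> \<le> L * norm h" and "L \<ge> 0"
  shows "L-lipschitz_on V (soft_minmax lam m M I J A)"
proof -
  have "\<exists>D. (soft_minmax lam m M I J A has_derivative D) (at x) \<and> onorm D \<le> L" for x
  proof (rule soft_minmax_derivative_bound[OF A', where c = "\<lambda>i j. L" and R = L and \<theta> = 0 and L = 0 and x = x])
    fix i
    have "(\<Sum>j\<in>J. exp (lam * A i j x) / T i x * L) = L"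
      using exp_sum_pos[of i x]
      by (simp add: sum_divide_distrib[symmetric] exp_sum_def sum_distrib_right[symmetric])
    then show "(\<Sum>j\<in>J. exp (lam * A i j x) / T i x * L) \<le> L \<or>
      inverse (T i x) \<le> 0 * S x \<and> (\<forall>j\<in>J. L \<le> 0)" by simp
  qed (use c \<open>L \<ge> 0\<close> in auto)
  then obtain D where D: "\<And>x. (soft_minmax lam m M I J A has_derivative D x) (at x)" "\<And>x. onorm (D x) \<le> L"
    by metis
  show ?thesis
  proof (rule lipschitz_onI)
    fix x y
    show "dist (soft_minmax lam m M I J A x) (soft_minmax lam m M I J A y) \<le> L * dist x y"
      unfolding dist_norm by (rule differentiable_bound[of UNIV _ D]) (use D in auto)
  qed fact
qed

end

section \<open>Cylindrical functions\<close>

lemma soft_minmax_elementary: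
  assumes "lam > 0" "finite J" "J \<noteq> {}"
    and A: "\<And>i j. i \<in> I \<Longrightarrow> j \<in> J \<Longrightarrow> A i j \<in> elementary N \<phi>"
  shows "soft_minmax lam m M I J A \<in> elementary N \<phi>"
proof -
  let ?S = "inverse_exp_sum lam I J A"
  have T: "exp_sum lam J B x > 0" for B x
    unfolding exp_sum_def using assms(2,3) by (intro sum_pos) auto
  have T': "exp_sum lam J (A i) \<in> elementary N \<phi>" if "i \<in> I" for i
    unfolding exp_sum_def[abs_def]
    by (rule elementary_sum, rule elementary.exp, rule elementary.mult, rule elementary.const) (rule A[OF that])
  have S: "?S \<in> elementary N \<phi>"
    unfolding inverse_exp_sum_def[abs_def]
    by (rule elementary_sum, rule elementary.inverse, erule T', rule T)
  have S0: "?S x \<ge> 0" for x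
    unfolding inverse_exp_sum_def using T by (intro sum_nonneg inverse_nonnegative_iff_nonnegative[THEN iffD2] less_imp_le)
  have ln: "(\<lambda>x. ln (?S x + exp c)) \<in> elementary N \<phi>" for c
    by (rule elementary.ln, rule elementary.add[OF S elementary.const])
      (use S0 in \<open>simp add: add_nonneg_pos\<close>)
  have "soft_minmax lam m M I J A = (\<lambda>x. m + inverse lam *
      (ln (?S x + exp (- lam * m)) + (- 1) * ln (?S x + exp (- lam * M))))"
    by (rule ext) (simp add: soft_minmax_def divide_inverse)
  also have "\<dots> \<in> elementary N \<phi>"
    by (rule elementary.add[OF elementary.const elementary.mult[OF elementary.const
          elementary.add[OF ln elementary.mult[OF elementary.const ln]]]])
  finally show ?thesis .
qed

lemma bounded_linear_apply_bcontfun: "bounded_linear (\<lambda>v :: 'a::topological_space \<Rightarrow>\<^sub>C real. apply_bcontfun v k)"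
  by (rule bounded_linear_intro[where K = 1]) (auto intro: norm_bounded[where 'b = real, simplified])

context
  fixes lam m M L :: real and I :: "'i set" and J :: "'j set" and N :: nat
    and \<kappa> :: "'j \<Rightarrow> nat" and \<alpha> \<beta> :: "'i \<Rightarrow> 'j \<Rightarrow> real"
  assumes lam: "lam > 0" and mM: "m \<le> M" and I: "finite I" and J: "finite J" "J \<noteq> {}"
    and \<kappa>: "\<And>j. j \<in> J \<Longrightarrow> \<kappa> j < N"
    and \<beta>: "\<And>i j. i \<in> I \<Longrightarrow> j \<in> J \<Longrightarrow> \<bar>\<beta> i j\<bar> \<le> L" and "L \<ge> 0"
begin

text \<open>The functionals are arbitrary because two cases occur: evaluations on the
  finite-dimensional target, for membership in \<open>Cyl\<close>, and norming functionals on the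
  Banach space itself.\<close>

lemma soft_minmax_affine_lipschitz:
  fixes l :: "nat \<Rightarrow> 'v::real_normed_vector \<Rightarrow> real"
  assumes l: "\<And>k. k < N \<Longrightarrow> bounded_linear (l k)" "\<And>k v. k < N \<Longrightarrow> \<bar>l k v\<bar> \<le> norm v"
  shows "L-lipschitz_on V (soft_minmax lam m M I J (\<lambda>i j v. \<alpha> i j + \<beta> i j * l (\<kappa> j) v))"
proof (rule soft_minmax_lipschitz[OF lam mM I J])
  fix i j x assume i: "i \<in> I" and j: "j \<in> J"
  have "((\<lambda>v. \<alpha> i j + \<beta> i j * l (\<kappa> j) v) has_derivative (\<lambda>h. 0 + \<beta> i j * l (\<kappa> j) h)) (at x)"
    by (intro has_derivative_add has_derivative_const has_derivative_mult_right
        bounded_linear_imp_has_derivative l(1) \<kappa> j)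
  then show "((\<lambda>v. \<alpha> i j + \<beta> i j * l (\<kappa> j) v) has_derivative (\<lambda>h. \<beta> i j * l (\<kappa> j) h)) (at x)"
    by simp
  fix h show "\<bar>\<beta> i j * l (\<kappa> j) h\<bar> \<le> L * norm h"
    unfolding abs_mult by (intro mult_mono \<beta> i j l(2) \<kappa> \<open>L \<ge> 0\<close> abs_ge_zero)
qed fact

text \<open>The target is spanned by the first \<open>N\<close> unit sequences. Evaluation at
  \<open>k\<close> has norm at most 1 for the supremum norm and satisfies
  \<open>\<phi> k (p x) = l k x\<close>, so the same formula written with evaluations is the outer
  function.\<close>

lemma soft_minmax_affine_Cyl:
  fixes l :: "nat \<Rightarrow> 'b::real_normed_vector \<Rightarrow> real"
  assumes l: "\<And>k. k < N \<Longrightarrow> bounded_linear (l k)"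
  shows "soft_minmax lam m M I J (\<lambda>i j x. \<alpha> i j + \<beta> i j * l (\<kappa> j) x) \<in> Cyl"
proof -
  define e :: "nat \<Rightarrow> nat \<Rightarrow>\<^sub>C real" where "e k = Bcontfun (\<lambda>n. if n = k then 1 else 0)" for k
  have "(\<lambda>n. if n = k then 1 else 0 :: real) \<in> bcontfun" for k :: nat
    by (rule bcontfun_normI[where b = 1]) auto
  then have e: "apply_bcontfun (e k) n = (if n = k then 1 else 0)" for k n
    by (simp add: e_def Bcontfun_inverse)
  define \<phi> :: "nat \<Rightarrow> (nat \<Rightarrow>\<^sub>C real) \<Rightarrow> real" where "\<phi> k v = apply_bcontfun v k" for k v
  have \<phi>_bl: "bounded_linear (\<phi> k)" for k
    unfolding \<phi>_def[abs_def] by (rule bounded_linear_apply_bcontfun)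
  have \<phi>_le: "\<bar>\<phi> k v\<bar> \<le> norm v" for k v
    unfolding \<phi>_def using norm_bounded[of v k] by simp
  define V where "V = span (e ` {..<N})"
  define p where "p x = (\<Sum>k<N. l k x *\<^sub>R e k)" for x
  define g where "g = soft_minmax lam m M I J (\<lambda>i j v. \<alpha> i j + \<beta> i j * \<phi> (\<kappa> j) v)"
  have p: "bounded_linear p"
    unfolding p_def by (intro bounded_linear_sum bounded_linear_scaleR_left[THEN bounded_linear_compose] l) auto
  have \<phi>p: "\<phi> k (p x) = l k x" if "k < N" for k x
  proof -
    have "\<phi> k (p x) = (\<Sum>i<N. l i x * \<phi> k (e i))"
      unfolding p_def linear_sum[OF bounded_linear.linear[OF \<phi>_bl]]
      by (simp add: linear_scale[OF bounded_linear.linear[OF \<phi>_bl]])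
    then show ?thesis using that by (simp add: \<phi>_def e mult_delta_right)
  qed
  have "range p \<subseteq> V"
    unfolding V_def p_def by (intro image_subsetI span_sum span_scale span_base imageI)
  moreover have "g \<in> C_infinity V"
    unfolding g_def
    by (rule elementary_C_infinity[OF \<phi>_bl \<phi>_le], rule soft_minmax_elementary[OF lam J],
        rule elementary.add[OF elementary.const elementary.mult[OF elementary.const elementary.coord]], rule \<kappa>)
  moreover have "g \<in> LIP_b V"
  proof -
    have "g ` V \<subseteq> {m..M}"
      unfolding g_def using soft_minmax_ge[OF lam mM I J] soft_minmax_le[OF lam mM I J] by auto
    then have "bounded (g ` V)" by (rule bounded_subset[rotated]) simp
    moreover have "L-lipschitz_on V g"
      unfolding g_def by (rule soft_minmax_affine_lipschitz) (rule \<phi>_bl \<phi>_le)+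
    ultimately show ?thesis unfolding LIP_b_def by blast
  qed
  moreover have "soft_minmax lam m M I J (\<lambda>i j x. \<alpha> i j + \<beta> i j * l (\<kappa> j) x) = g \<circ> p"
    unfolding g_def soft_minmax_def inverse_exp_sum_def exp_sum_def
    by (rule ext) (simp add: \<phi>p \<kappa> cong: sum.cong)
  moreover have "\<exists>S. finite S \<and> V = span S"
    unfolding V_def by (intro exI[of _ "e ` {..<N}"] conjI finite_imageI finite_lessThan refl)
  ultimately show ?thesis
    unfolding Cyl_def using p
    by - (rule CollectI, rule exI[of _ V], rule exI[of _ g], rule exI[of _ p], intro conjI IntI)
qed

end

section \<open>Approximation on compact sets\<close>

lemma Lip_le: "L-lipschitz_on A f \<Longrightarrow> Lip f A \<le> L"
  unfolding Lip_def by (rule cInf_lower) (auto intro!: bdd_belowI[of _ 0] dest: lipschitz_on_nonneg)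

text \<open>Every admissible constant bounds each difference quotient, hence so does their infimum:
  it is attained.\<close>

lemma lipschitz_on_Lip:
  assumes "L-lipschitz_on A f"
  shows "(Lip f A)-lipschitz_on A f"
proof (rule lipschitz_onI)
  have ne: "{L. L-lipschitz_on A f} \<noteq> {}" using assms by auto
  show "0 \<le> Lip f A"
    unfolding Lip_def using ne by (rule cInf_greatest) (auto dest: lipschitz_on_nonneg)
  fix x y assume xy: "x \<in> A" "y \<in> A"
  show "dist (f x) (f y) \<le> Lip f A * dist x y"
  proof (cases "x = y")
    case False
    have "dist (f x) (f y) / dist x y \<le> Lip f A"
      unfolding Lip_def using ne
      by (rule cInf_greatest) (use False xy in \<open>auto simp: divide_le_eq dest: lipschitz_onD\<close>)
    then show ?thesis using False by (simp add: divide_le_eq)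
  qed simp
qed

lemma Lip_mono: "L-lipschitz_on B f \<Longrightarrow> A \<subseteq> B \<Longrightarrow> Lip f A \<le> Lip f B"
  by (rule Lip_le) (rule lipschitz_on_subset[OF lipschitz_on_Lip])

lemma eventually_divide_le:
  fixes C :: real
  assumes "\<delta> > 0"
  shows "\<forall>\<^sub>F x in at_top. C / x \<le> \<delta>"
  using eventually_ge_at_top[of "C / \<delta>"] eventually_gt_at_top[of 0]
  by eventually_elim (use assms in \<open>simp add: field_simps\<close>)

lemma eventually_mult_exp_le:
  fixes C :: real
  assumes "\<delta> > 0" "C \<ge> 0" "d > 0"
  shows "\<forall>\<^sub>F x in at_top. C * exp (- x * d) \<le> \<delta>"
  using eventually_divide_le[OF assms(1), of "C / d"] eventually_gt_at_top[of 0]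
proof eventually_elim
  case (elim x)
  have "x * d \<le> exp (x * d)" "x * d > 0"
    using exp_ge_add_one_self[of "x * d"] elim(2) assms(3) by (linarith, simp)
  then have "exp (- x * d) \<le> 1 / (x * d)"
    using le_imp_inverse_le[of "x * d" "exp (x * d)"] by (simp add: exp_minus divide_inverse)
  then have "C * exp (- x * d) \<le> C * (1 / (x * d))" by (intro mult_left_mono assms(2))
  also have "\<dots> = C / d / x" by (simp add: mult.commute)
  finally show ?case using elim(1) by simp
qed

text \<open>
  The branches \<open>(k, True)\<close> have the small slope \<open>a i\<close>, the branches \<open>(k, False)\<close> the slope
  \<open>L = Lip f UNIV + \<epsilon>\<close>. Since \<open>L * t - c \<ge> Lip f UNIV * t + c\<close> for \<open>t \<ge> 2 * r\<close>, the latter keep far away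
  nodes out of the minimum; since \<open>L * s = c / 2\<close>, they are inactive at distance at most \<open>s\<close> from the node.
\<close>

lemma compact_approximation:
  fixes f :: "'b::real_normed_vector \<Rightarrow> real"
  assumes f: "f \<in> LIP_b UNIV" and K: "compact K"
    and "\<epsilon> > 0" "r > 0" "\<delta> > 0" "\<delta> \<le> \<epsilon>"
  shows "\<exists>F\<in>Cyl. (\<forall>x. (INF y. f y) \<le> F x \<and> F x \<le> (SUP y. f y)) \<and>
    (Lip f UNIV + \<epsilon>)-lipschitz_on UNIV F \<and>
    (\<forall>x\<in>K. \<bar>F x - f x\<bar> \<le> 2 * \<delta> \<and>
      onorm (frechet_derivative F (at x)) \<le> Lip f (ball x (3 * r)) + 3 * \<delta>)"
proof -
  define m M where "m = (INF y. f y)" and "M = (SUP y. f y)"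
  have bdd: "bounded (range f)" and lip: "\<exists>L. L-lipschitz_on UNIV f" using f by (auto simp: LIP_b_def)
  have mf: "m \<le> f x" and fM: "f x \<le> M" for x
    unfolding m_def M_def using bdd
    by (auto intro!: cINF_lower cSUP_upper bounded_imp_bdd_above bounded_imp_bdd_below)
  have mM: "m \<le> M" using mf fM by (rule order.trans)
  have lipA: "(Lip f A)-lipschitz_on A f" for A
    using lip lipschitz_on_subset[OF _ subset_UNIV] lipschitz_on_Lip by metis
  define L0 where "L0 = Lip f UNIV"
  have L0: "L0 \<ge> 0" "\<bar>f x - f y\<bar> \<le> L0 * norm (x - y)" for x y
    using lipschitz_on_nonneg[OF lipA[of UNIV]] lipschitz_onD[OF lipA[of UNIV], of x y]
    by (simp_all add: L0_def dist_norm)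
  define L where "L = L0 + \<epsilon>"
  define c where "c = r * \<epsilon>"
  define s where "s = c / (2 * L)"
  \<comment> \<open>\<open>g\<close> is the height by which the cone of a node farther than
    \<open>s\<close> exceeds \<open>f\<close>: the surplus slope \<open>\<delta>\<close> gives
    \<open>\<delta> * s\<close>, the steep branches give \<open>c\<close>. The net costs at most
    \<open>\<kappa>\<close> in each direction, so \<open>3 * \<kappa> \<le> g\<close> leaves a
    margin \<open>\<kappa>\<close> for the exponential weights. \<open>\<eta>\<close> makes an error
    of \<open>2 * \<eta>\<close> in the norm cost at most \<open>\<kappa>\<close> under slope
    \<open>L\<close>.\<close>
  define g where "g = min (\<delta> * s) c"
  define \<kappa> where "\<kappa> = min (g / 3) \<delta>"
  define \<eta> where "\<eta> = \<kappa> / (2 * L)"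
  have L: "L > 0" using L0 \<open>\<epsilon> > 0\<close> by (simp add: L_def)
  have c: "c > 0" using \<open>\<epsilon> > 0\<close> \<open>r > 0\<close> by (simp add: c_def)
  have s: "s > 0" "L * s = c / 2" using c L by (simp_all add: s_def)
  have "\<epsilon> \<le> 2 * L" using L0(1) \<open>\<epsilon> > 0\<close> by (simp add: L_def)
  then have sr: "s \<le> r" using L \<open>r > 0\<close> by (simp add: s_def c_def divide_le_eq)
  have g: "g > 0" using c s \<open>\<delta> > 0\<close> by (simp add: g_def)
  have \<kappa>: "\<kappa> > 0" "\<kappa> \<le> \<delta>" "3 * \<kappa> \<le> g" using g \<open>\<delta> > 0\<close> by (simp_all add: \<kappa>_def min_def)
  have \<eta>: "\<eta> > 0" "2 * L * \<eta> = \<kappa>" using \<kappa> L by (simp_all add: \<eta>_def)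
  obtain X where X: "finite X" "X \<subseteq> K" "K \<subseteq> (\<Union>x\<in>X. ball x \<eta>)"
    using seq_compact_imp_totally_bounded[OF compact_imp_seq_compact[OF K], rule_format, OF \<eta>(1)] by metis
  obtain N :: nat and l :: "nat \<Rightarrow> 'b \<Rightarrow> real"
    where l: "\<And>k. bounded_linear (l k)" "\<And>k x. \<bar>l k x\<bar> \<le> norm x"
      and norming: "\<And>z. z \<in> (\<lambda>(x, y). x - y) ` (X \<times> X) \<Longrightarrow> \<exists>k<N. l k z = norm z"
      and N: "N > 0" and l0: "\<And>x. l 0 x = 0"
    by (rule norming_family[OF finite_imageI[OF finite_cartesian_product[OF X(1) X(1)],
          of "\<lambda>(x, y). x - y"]]) (rule that; assumption)
  have l_diff: "l k (x - y) = l k x - l k y" for k x y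
    by (rule linear_diff[OF bounded_linear.linear[OF l(1)]])

  define a where "a i = Lip f (ball i (2 * r)) + \<delta>" for i
  have Lipball: "0 \<le> Lip f (ball i (2 * r))" "Lip f (ball i (2 * r)) \<le> L0" for i
    using lipschitz_on_nonneg[OF lipA] Lip_mono[OF lipA[of UNIV]] by (auto simp: L0_def)
  have a: "0 \<le> a i" "a i \<le> L" for i
    using Lipball[of i] \<open>\<delta> > 0\<close> \<open>\<delta> \<le> \<epsilon>\<close> by (simp_all add: a_def L_def)
  define J where "J = {..<N} \<times> (UNIV :: bool set)"
  define \<beta> where "\<beta> i j = (if snd j then a i else L)" for i and j :: "nat \<times> bool"
  define \<alpha> where "\<alpha> i j = f i - \<beta> i j * l (fst j) i - (if snd j then 0 else c)" for i and j :: "nat \<times> bool"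
  define A where "A i j x = \<alpha> i j + \<beta> i j * l (fst j) x" for i j x
  have A_eq: "A i (k, b) x = f i + (if b then a i * l k (x - i) else L * l k (x - i) - c)" for i k b x
    by (simp add: A_def \<alpha>_def \<beta>_def l_diff right_diff_distrib)
  have J: "finite J" "J \<noteq> {}" and cardJ: "card J = 2 * N"
    using N by (auto simp: J_def card_cartesian_product)
  have \<beta>: "0 \<le> \<beta> i j" "\<beta> i j \<le> L" for i j using a L by (auto simp: \<beta>_def)

  \<comment> \<open>The two logarithms are the errors of the soft minimum and soft maximum; the
    third condition silences the steep branches of near nodes, the fourth the far nodes.\<close>
  have "\<forall>\<^sub>F lam in at_top. (ln (real (card X) + 1) / lam \<le> \<delta> \<and> ln (real (2 * N) + 1) / lam \<le> \<delta>) \<and>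
      real (2 * N) * L * exp (- lam * (c / 2)) \<le> \<delta> \<and>
      real (card X) * real (2 * N) * L * exp (- lam * \<kappa>) \<le> \<delta> \<and> lam > 0"
    using L \<kappa> c \<open>\<delta> > 0\<close>
    by (intro eventually_conj eventually_divide_le eventually_mult_exp_le eventually_gt_at_top) auto
  then obtain lam :: real where lam: "lam > 0" and lam1: "ln (real (card X) + 1) / lam \<le> \<delta>"
    and lam2: "ln (real (2 * N) + 1) / lam \<le> \<delta>"
    and lam3: "real (2 * N) * L * exp (- lam * (c / 2)) \<le> \<delta>"
    and lam4: "real (card X) * real (2 * N) * L * exp (- lam * \<kappa>) \<le> \<delta>"
    using eventually_happens[of _ "at_top :: real filter"] by auto
  let ?T = "\<lambda>i x. exp_sum lam J (A i) x" and ?S = "\<lambda>x. inverse_exp_sum lam X J A x"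
  define F where "F = soft_minmax lam m M X J A"
  have FA: "F = soft_minmax lam m M X J (\<lambda>i j x. \<alpha> i j + \<beta> i j * l (fst j) x)"
    by (simp add: F_def A_def[abs_def])
  have fst: "\<And>j. j \<in> J \<Longrightarrow> fst j < N" by (auto simp: J_def)
  have \<beta>_abs: "\<bar>\<beta> i j\<bar> \<le> L" for i j using \<beta>[of i j] by simp
  have Cyl: "F \<in> Cyl"
    unfolding FA by (rule soft_minmax_affine_Cyl[OF lam mM X(1) J fst \<beta>_abs less_imp_le[OF L] l(1)])
  have lipF: "L-lipschitz_on UNIV F"
    unfolding FA by (rule soft_minmax_affine_lipschitz[OF lam mM X(1) J fst \<beta>_abs less_imp_le[OF L] l])
  have term_le: "exp (lam * A i j x) \<le> ?T i x" if "j \<in> J" for i j x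
    unfolding exp_sum_def using that J by (intro member_le_sum) auto
  have Tpos: "?T i x > 0" for i x by (rule exp_sum_pos[OF lam mM X(1) J])

  have point: "\<bar>F x - f x\<bar> \<le> 2 * \<delta> \<and> onorm (frechet_derivative F (at x)) \<le> Lip f (ball x (3 * r)) + 3 * \<delta>"
    if x: "x \<in> K" for x
  proof -
    obtain y where y: "y \<in> X" "norm (x - y) \<le> \<eta>"
      using X(3) x by (force simp: dist_norm norm_minus_commute)
    have lower: "exp (lam * (f x + (if s < norm (x - i) then g else 0) - \<kappa>)) \<le> ?T i x" if i: "i \<in> X" for i
    proof -
      let ?t = "norm (x - i)"
      \<comment> \<open>The point \<open>x\<close> is not a node, so the functional norming
        \<open>y - i\<close> is used for its neighbour \<open>y\<close>; passing from
        \<open>y\<close> to \<open>x\<close> costs \<open>\<eta>\<close> in the norm and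
        \<open>\<eta>\<close> in the functional.\<close>
      obtain k where k: "k < N" "l k (y - i) = norm (y - i)" using norming y(1) i by force
      have "?t \<le> norm (y - i) + \<eta>" using norm_triangle_ineq[of "x - y" "y - i"] y(2) by simp
      moreover have "l k (x - i) = norm (y - i) + l k (x - y)" using k(2) by (simp add: l_diff)
      moreover have "l k (x - y) \<ge> - \<eta>" using l(2)[of k "x - y"] y(2) by linarith
      ultimately have lk: "l k (x - i) \<ge> ?t - 2 * \<eta>" by linarith
      \<comment> \<open>Within distance \<open>2 * r\<close> the gentle branch suffices, its surplus
        slope \<open>\<delta>\<close> paying for \<open>g\<close> beyond \<open>s\<close>. Farther
        out the steep branch gains \<open>\<epsilon> * (2 * r) - c = c\<close>, which is at least
        \<open>g\<close>.\<close>
      have "\<exists>b. f x + (if s < ?t then g else 0) - \<kappa> \<le> A i (k, b) x"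
      proof (cases "?t < 2 * r")
        case True
        have "f x - f i \<le> Lip f (ball i (2 * r)) * ?t"
          using lipschitz_onD[OF lipA[of "ball i (2 * r)"], of x i] True \<open>r > 0\<close>
          by (simp add: dist_norm norm_minus_commute)
        moreover have "a i * (?t - 2 * \<eta>) \<le> a i * l k (x - i)"
          using lk a by (intro mult_left_mono)
        moreover have "a i * (2 * \<eta>) \<le> L * (2 * \<eta>)"
          using a \<eta>(1) by (intro mult_right_mono) auto
        moreover have "(if s < ?t then g else 0) \<le> \<delta> * ?t"
        proof (cases "s < ?t")
          case True
          then have "\<delta> * s \<le> \<delta> * ?t" using \<open>\<delta> > 0\<close> by simp
          moreover have "g \<le> \<delta> * s" by (simp add: g_def)
          ultimately show ?thesis using True by simp
        qed (use \<open>\<delta> > 0\<close> in simp)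
        ultimately have "f x + (if s < ?t then g else 0) - \<kappa> \<le> A i (k, True) x"
          using \<eta>(2) by (simp add: A_eq a_def algebra_simps)
        then show ?thesis ..
      next
        case False
        have "L * (?t - 2 * \<eta>) \<le> L * l k (x - i)"
          using lk L by (intro mult_left_mono) auto
        moreover have "f x - f i \<le> L0 * ?t" using L0(2)[of x i] by simp
        moreover have "\<epsilon> * (2 * r) \<le> \<epsilon> * ?t" using False \<open>\<epsilon> > 0\<close> by (intro mult_left_mono) auto
        moreover have "(if s < ?t then g else 0) \<le> c" using c by (auto simp: g_def)
        ultimately have "f x + (if s < ?t then g else 0) - \<kappa> \<le> A i (k, False) x"
          using \<eta>(2) by (simp add: A_eq L_def c_def algebra_simps)
        then show ?thesis ..
      qed
      then obtain b where b: "f x + (if s < ?t then g else 0) - \<kappa> \<le> A i (k, b) x" ..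
      have "exp (lam * (f x + (if s < ?t then g else 0) - \<kappa>)) \<le> exp (lam * A i (k, b) x)"
        using mult_left_mono[OF b, of lam] lam by simp
      also have "\<dots> \<le> ?T i x" by (rule term_le) (simp add: J_def k(1))
      finally show ?thesis .
    qed
    \<comment> \<open>\<open>L * \<eta>\<close> is half of \<open>\<kappa>\<close>: one half pays
      for \<open>f y - f x\<close>, the other for the slope term.\<close>
    have "A y j x \<le> f x + \<kappa>" if "j \<in> J" for j
    proof -
      obtain k b where j: "j = (k, b)" by (cases j)
      have "l k (x - y) \<le> \<eta>" using l(2)[of k "x - y"] y(2) by linarith
      then have "a y * l k (x - y) \<le> a y * \<eta>" "L * l k (x - y) \<le> L * \<eta>"
        using a[of y] L by (auto intro: mult_left_mono)
      moreover have "a y * \<eta> \<le> L * \<eta>" using a[of y] \<eta>(1) by simp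
      moreover have "f y - f x \<le> L * \<eta>"
      proof -
        have "f y - f x \<le> L0 * norm (x - y)" using L0(2)[of y x] by (simp add: norm_minus_commute)
        also have "\<dots> \<le> L * \<eta>" using y(2) L0(1) L \<open>\<epsilon> > 0\<close> by (intro mult_mono) (auto simp: L_def)
        finally show ?thesis .
      qed
      ultimately show ?thesis using \<eta>(2) c by (simp add: j A_eq)
    qed
    then have "?T y x \<le> (\<Sum>j\<in>J. exp (lam * (f x + \<kappa>)))"
      unfolding exp_sum_def using lam by (intro sum_mono) simp
    then have upper: "?T y x \<le> real (2 * N) * exp (lam * (f x + \<kappa>))" by (simp add: cardJ)
    have N2: "real (2 * N) > 0" using N by simp

    have T_ge: "exp (lam * (f x - \<kappa>)) \<le> ?T i x" if "i \<in> X" for i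
    proof -
      have "exp (lam * (f x - \<kappa>)) \<le> exp (lam * (f x + (if s < norm (x - i) then g else 0) - \<kappa>))"
        using lam g by simp
      with lower[OF that] show ?thesis by linarith
    qed
    have "f x - \<kappa> - ln (real (card X) + 1) / lam \<le> F x"
      unfolding F_def by (rule soft_minmax_lower[OF lam mM X(1) J fM less_imp_le[OF \<kappa>(1)]]) (rule T_ge)
    then have "f x - F x \<le> 2 * \<delta>" using lam1 \<kappa>(2) by simp
    moreover have "F x \<le> f x + \<kappa> + ln (real (2 * N) + 1) / lam"
      unfolding F_def
      by (rule soft_minmax_upper[OF lam mM X(1) J mf less_imp_le[OF \<kappa>(1)] y(1)]) (rule upper N2)+
    then have "F x - f x \<le> 2 * \<delta>" using lam2 \<kappa>(2) by simp
    ultimately have val: "\<bar>F x - f x\<bar> \<le> 2 * \<delta>" by linarith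

    \<comment> \<open>One \<open>\<delta>\<close> is the surplus in \<open>a i\<close>, the other
      bounds the steep branches; the far nodes will add a third. The radius \<open>3 * r\<close> is
      \<open>2 * r\<close> plus the distance to a near node, at most
      \<open>s \<le> r\<close>.\<close>
    define R where "R = Lip f (ball x (3 * r)) + 2 * \<delta>"
    define \<theta> where "\<theta> = real (2 * N) * exp (- lam * \<kappa>)"
    have "R \<ge> 0" using lipschitz_on_nonneg[OF lipA[of "ball x (3 * r)"]] \<open>\<delta> > 0\<close> by (simp add: R_def)
    have near: "(\<Sum>j\<in>J. exp (lam * A i j x) / ?T i x * \<beta> i j) \<le> R" if i: "i \<in> X" and t: "norm (x - i) \<le> s" for i
    proof -
      \<comment> \<open>The zero functional at work: the branch \<open>(0, True)\<close> equals
        \<open>f i\<close> at every point, while near the node the steep branches stay below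
        \<open>f i - c / 2\<close>.\<close>
      have "exp (lam * f i) = exp (lam * A i (0, True) x)" by (simp add: A_eq l0)
      also have "\<dots> \<le> ?T i x" by (rule term_le) (simp add: J_def N)
      finally have T: "exp (lam * f i) \<le> ?T i x" .
      have steep: "exp (lam * A i j x) / ?T i x \<le> exp (- lam * (c / 2))" if "\<not> snd j" for j
      proof -
        define k where "k = fst j"
        have j: "j = (k, False)" using that by (simp add: k_def prod_eq_iff)
        have "l k (x - i) \<le> s" using l(2)[of k "x - i"] t by linarith
        then have "L * l k (x - i) \<le> L * s" using L by simp
        then have "A i j x \<le> f i - c / 2" using s(2) by (simp add: j A_eq)
        then have "lam * A i j x \<le> lam * f i + - lam * (c / 2)"
          using mult_left_mono[of "A i j x" "f i - c / 2" lam] lam by (simp add: right_diff_distrib)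
        then have "exp (lam * A i j x) \<le> exp (lam * f i + - lam * (c / 2))" by (simp only: exp_le_cancel_iff)
        also have "\<dots> = exp (- lam * (c / 2)) * exp (lam * f i)"
          by (simp only: exp_add mult.commute)
        also have "\<dots> \<le> exp (- lam * (c / 2)) * ?T i x" by (intro mult_left_mono T) simp
        finally show ?thesis using Tpos[of i x] by (simp add: divide_le_eq)
      qed
      have "exp (lam * A i j x) / ?T i x * \<beta> i j \<le>
          exp (lam * A i j x) / ?T i x * a i + exp (- lam * (c / 2)) * L" for j
      proof (cases "snd j")
        case False
        have "exp (lam * A i j x) / ?T i x * L \<le> exp (- lam * (c / 2)) * L"
          using steep[OF False] L by (intro mult_right_mono) auto
        moreover have "0 \<le> exp (lam * A i j x) / ?T i x * a i" using Tpos[of i x] a by simp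
        ultimately show ?thesis using False by (simp add: \<beta>_def)
      qed (use L in \<open>simp add: \<beta>_def\<close>)
      then have "(\<Sum>j\<in>J. exp (lam * A i j x) / ?T i x * \<beta> i j) \<le>
          (\<Sum>j\<in>J. exp (lam * A i j x) / ?T i x * a i + exp (- lam * (c / 2)) * L)"
        by (intro sum_mono)
      also have "\<dots> = (\<Sum>j\<in>J. exp (lam * A i j x) / ?T i x) * a i + real (2 * N) * L * exp (- lam * (c / 2))"
        by (simp only: sum.distrib sum_distrib_right[symmetric] sum_constant cardJ) (simp only: mult_ac)
      also have "(\<Sum>j\<in>J. exp (lam * A i j x) / ?T i x) = 1"
        using Tpos[of i x] by (simp add: sum_divide_distrib[symmetric] exp_sum_def)
      also have "1 * a i + real (2 * N) * L * exp (- lam * (c / 2)) \<le> a i + \<delta>" using lam3 by simp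
      also have "a i \<le> Lip f (ball x (3 * r)) + \<delta>"
      proof -
        have "ball i (2 * r) \<subseteq> ball x (3 * r)"
        proof
          fix z assume "z \<in> ball i (2 * r)"
          then show "z \<in> ball x (3 * r)"
            using t sr dist_triangle[of x z i] by (simp add: dist_norm)
        qed
        then show ?thesis unfolding a_def using Lip_mono[OF lipA] by auto
      qed
      finally show ?thesis by (simp add: R_def)
    qed
    \<comment> \<open>A far node has height at least \<open>f x + 2 * \<kappa>\<close>, whereas
      \<open>y\<close> alone contributes to the sum as a height of \<open>f x + \<kappa>\<close>, up
      to the factor \<open>2 * N\<close>; \<open>\<theta>\<close> is the quotient.\<close>
    have far: "inverse (?T i x) \<le> \<theta> * ?S x" if i: "i \<in> X" and t: "norm (x - i) > s" for i
    proof -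
      have "exp (lam * (f x + 2 * \<kappa>)) \<le> exp (lam * (f x + g - \<kappa>))" using lam \<kappa>(3) by simp
      also have "\<dots> \<le> ?T i x" using lower[OF i] t by simp
      finally have "inverse (?T i x) \<le> inverse (exp (lam * (f x + 2 * \<kappa>)))"
        by (rule le_imp_inverse_le) simp
      also have "\<dots> = \<theta> * (exp (- lam * (f x + \<kappa>)) / real (2 * N))"
        using N2 by (simp add: \<theta>_def exp_minus[symmetric] exp_add[symmetric] algebra_simps)
      also have "\<dots> \<le> \<theta> * ?S x"
      proof (rule mult_left_mono)
        show "exp (- lam * (f x + \<kappa>)) / real (2 * N) \<le> ?S x"
          by (rule inverse_exp_sum_ge[OF lam mM X(1) J y(1)]) (rule upper N2)+
      qed (simp add: \<theta>_def)
      finally show ?thesis .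
    qed
    have dA: "(A i j has_derivative (\<lambda>h. \<beta> i j * l (fst j) h)) (at x)" for i j
    proof -
      have "((\<lambda>x. \<alpha> i j + \<beta> i j * l (fst j) x) has_derivative (\<lambda>h. 0 + \<beta> i j * l (fst j) h)) (at x)"
        by (intro has_derivative_add has_derivative_const has_derivative_mult_right
            bounded_linear_imp_has_derivative l(1))
      then show ?thesis by (simp add: A_def[abs_def])
    qed
    have dA_le: "\<bar>\<beta> i j * l (fst j) h\<bar> \<le> \<beta> i j * norm h" for i j h
      using \<beta>[of i j] l(2) by (simp add: abs_mult mult_left_mono)
    obtain D where D: "(F has_derivative D) (at x)" "onorm D \<le> R + real (card X) * \<theta> * L"
      unfolding F_def
    proof (rule soft_minmax_derivative_bound[OF lam mM X(1) J dA dA_le \<open>R \<ge> 0\<close>])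
      show "0 \<le> \<theta>" by (simp add: \<theta>_def)
      show "0 \<le> L" using L by simp
      show "(\<Sum>j\<in>J. exp (lam * A i j x) / ?T i x * \<beta> i j) \<le> R \<or>
          inverse (?T i x) \<le> \<theta> * ?S x \<and> (\<forall>j\<in>J. \<beta> i j \<le> L)" if "i \<in> X" for i
        using near[OF that] far[OF that] \<beta>(2) by (cases "norm (x - i) \<le> s") auto
    qed
    have "real (card X) * \<theta> * L \<le> \<delta>" using lam4 by (simp add: \<theta>_def mult_ac)
    with D have "onorm (frechet_derivative F (at x)) \<le> Lip f (ball x (3 * r)) + 3 * \<delta>"
      using frechet_derivative_at[OF D(1)] by (simp add: R_def)
    with val show ?thesis ..
  qed
  show ?thesis
  proof (rule bexI[OF _ Cyl], intro conjI allI ballI)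
    show "(INF y. f y) \<le> F x" "F x \<le> (SUP y. f y)" for x
      using soft_minmax_ge[OF lam mM X(1) J] soft_minmax_le[OF lam mM X(1) J] by (simp_all add: F_def m_def M_def)
    show "(Lip f UNIV + \<epsilon>)-lipschitz_on UNIV F" using lipF by (simp add: L_def L0_def)
  qed (use point in blast)+
qed

section \<open>Exhaustion\<close>

lemma sigma_compact_exhaustion:
  fixes E :: "'a::topological_space set"
  assumes "sigma_compact E"
  obtains K :: "nat \<Rightarrow> 'a set" where "\<And>n. compact (K n)" "incseq K" "E = (\<Union>n. K n)"
proof -
  obtain \<K> where \<K>: "countable \<K>" "\<forall>K\<in>\<K>. compact K" "E = \<Union>\<K>"
    using assms by (auto simp: sigma_compact_def)
  \<comment> \<open>The empty set is inserted so that there is something to enumerate even when the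
    family is empty.\<close>
  define C where "C = from_nat_into (insert {} \<K>)"
  have ran: "range C = insert {} \<K>"
    unfolding C_def by (rule range_from_nat_into) (use \<K>(1) in auto)
  then have comp: "compact (C k)" for k using \<K>(2) by (metis compact_empty insertE rangeI)
  show ?thesis
  proof
    show "compact (\<Union>k\<le>n. C k)" for n by (rule compact_UN) (auto simp: comp)
    show "incseq (\<lambda>n. \<Union>k\<le>n. C k)" by (auto simp: incseq_def intro: order.trans)
    have "(\<Union>n. \<Union>k\<le>n. C k) = \<Union>(range C)" by auto
    then show "E = (\<Union>n. \<Union>k\<le>n. C k)" by (simp add: ran \<K>(3))
  qed
qed

text \<open>Choose a radius at which the local Lipschitz constant is almost
  \<open>lip_a f x\<close>; by monotonicity all eventually smaller balls do at least as
  well.\<close>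

lemma limsup_le_lip_a:
  assumes f: "f \<in> LIP_b UNIV" and r: "r \<longlonglongrightarrow> 0"
    and le: "\<forall>\<^sub>F n in sequentially. u n \<le> Lip f (ball x (3 * r n)) + 3 * r n"
  shows "limsup (\<lambda>n. ereal (u n)) \<le> ereal (lip_a f x)"
proof (rule ereal_le_epsilon2)
  fix e :: real assume e: "e > 0"
  obtain L where L: "L-lipschitz_on UNIV f" using f by (auto simp: LIP_b_def)
  have lip: "L-lipschitz_on A f" for A by (rule lipschitz_on_subset[OF L]) simp
  have "0 \<le> Lip f A" for A by (rule lipschitz_on_nonneg[OF lipschitz_on_Lip[OF lip]])
  then have bdd: "bdd_below ((\<lambda>\<rho>. Lip f (ball x \<rho>)) ` {0<..})" by (intro bdd_belowI2)
  have "(INF \<rho>\<in>{0<..}. Lip f (ball x \<rho>)) < lip_a f x + e / 2" using e by (simp add: lip_a_def)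
  then obtain \<rho> where \<rho>: "\<rho> > 0" "Lip f (ball x \<rho>) < lip_a f x + e / 2"
    using cINF_less_iff[OF _ bdd] by auto
  have "\<forall>\<^sub>F n in sequentially. r n < min \<rho> (e / 2) / 3"
    by (rule order_tendstoD(2)[OF r]) (use \<rho> e in simp)
  with le have "\<forall>\<^sub>F n in sequentially. ereal (u n) \<le> ereal (lip_a f x + e)"
  proof eventually_elim
    case (elim n)
    then have "Lip f (ball x (3 * r n)) \<le> Lip f (ball x \<rho>)"
      by (intro Lip_mono[OF lip] subset_ball) simp
    with elim \<rho>(2) show ?case by simp
  qed
  then show "limsup (\<lambda>n. ereal (u n)) \<le> ereal (lip_a f x) + ereal e"
    by (simp add: Limsup_bounded)
qed

theorem mainTheorem3:
  fixes \<mu> :: "'b::banach measure" and E :: "'b set" and f :: "'b \<Rightarrow> real" and \<epsilon> :: real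
  assumes "finite_measure \<mu>" and "sets \<mu> = sets borel"
    and "sigma_compact E" and "emeasure \<mu> (UNIV - E) = 0"
    and "f \<in> LIP_b UNIV" and "\<epsilon> > 0"
  shows "\<exists>F :: nat \<Rightarrow> 'b \<Rightarrow> real.
    (\<forall>n. F n \<in> Cyl) \<and>
    (\<forall>n x. (INF y. f y) \<le> F n x \<and> F n x \<le> (SUP y. f y)) \<and>
    (SUP n. ereal (Lip (F n) UNIV)) \<le> ereal (Lip f UNIV + \<epsilon>) \<and>
    (AE x in \<mu>. (\<lambda>n. F n x) \<longlonglongrightarrow> f x \<and>
       limsup (\<lambda>n. ereal (onorm (frechet_derivative (F n) (at x)))) \<le> ereal (lip_a f x))"
proof -
  obtain K :: "nat \<Rightarrow> 'b set" where K: "\<And>n. compact (K n)" "incseq K" "E = (\<Union>n. K n)"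
    using sigma_compact_exhaustion[OF assms(3)] by blast
  \<comment> \<open>The same number is radius and tolerance in \<open>compact_approximation\<close>;
    the minimum ensures that the tolerance is at most \<open>\<epsilon>\<close>.\<close>
  define r where "r n = min \<epsilon> (1 / real (Suc n))" for n
  have r: "r n > 0" "r n \<le> \<epsilon>" for n using assms(6) by (auto simp: r_def)
  have "(\<lambda>n. min \<epsilon> (1 / real (Suc n))) \<longlonglongrightarrow> min \<epsilon> 0"
    by (intro tendsto_min tendsto_const LIMSEQ_Suc[OF lim_1_over_n])
  then have r0: "r \<longlonglongrightarrow> 0" using assms(6) by (simp add: r_def[abs_def])
  have "\<forall>n. \<exists>F. F \<in> Cyl \<and> (\<forall>x. (INF y. f y) \<le> F x \<and> F x \<le> (SUP y. f y)) \<and>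
      (Lip f UNIV + \<epsilon>)-lipschitz_on UNIV F \<and>
      (\<forall>x\<in>K n. \<bar>F x - f x\<bar> \<le> 2 * r n \<and>
        onorm (frechet_derivative F (at x)) \<le> Lip f (ball x (3 * r n)) + 3 * r n)"
    using compact_approximation[OF assms(5) K(1) assms(6) r(1) r] by blast
  from choice[OF this] obtain F :: "nat \<Rightarrow> 'b \<Rightarrow> real" where
    Cyl: "\<And>n. F n \<in> Cyl" and bounds: "\<And>n x. (INF y. f y) \<le> F n x \<and> F n x \<le> (SUP y. f y)" and
    lip: "\<And>n. (Lip f UNIV + \<epsilon>)-lipschitz_on UNIV (F n)" and
    on_K: "\<And>n x. x \<in> K n \<Longrightarrow> \<bar>F n x - f x\<bar> \<le> 2 * r n"
      "\<And>n x. x \<in> K n \<Longrightarrow> onorm (frechet_derivative (F n) (at x)) \<le> Lip f (ball x (3 * r n)) + 3 * r n"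
    by blast
  \<comment> \<open>The sets \<open>K n\<close> increase, so each point of \<open>E\<close> lies in
    all but finitely many of them, and both limit statements hold everywhere on \<open>E\<close>.
    The measure enters only through the null complement.\<close>
  have conv: "(\<lambda>n. F n x) \<longlonglongrightarrow> f x \<and>
       limsup (\<lambda>n. ereal (onorm (frechet_derivative (F n) (at x)))) \<le> ereal (lip_a f x)"
    if "x \<in> E" for x
  proof
    obtain n0 where "x \<in> K n0" using \<open>x \<in> E\<close> K(3) by blast
    then have "x \<in> K n" if "n \<ge> n0" for n using incseqD[OF K(2) that] by blast
    then have ev: "\<forall>\<^sub>F n in sequentially. x \<in> K n" by (auto simp: eventually_sequentially)
    have "(\<lambda>n. 2 * r n) \<longlonglongrightarrow> 0" using tendsto_mult_right_zero[OF r0] .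
    moreover have "\<forall>\<^sub>F n in sequentially. norm (F n x - f x) \<le> 2 * r n"
      using ev by eventually_elim (simp add: on_K(1))
    ultimately have "(\<lambda>n. F n x - f x) \<longlonglongrightarrow> 0" by (rule Lim_null_comparison[rotated])
    then show "(\<lambda>n. F n x) \<longlonglongrightarrow> f x" by (rule LIM_zero_cancel)
    have "\<forall>\<^sub>F n in sequentially. onorm (frechet_derivative (F n) (at x)) \<le> Lip f (ball x (3 * r n)) + 3 * r n"
      using ev by eventually_elim (rule on_K(2))
    then show "limsup (\<lambda>n. ereal (onorm (frechet_derivative (F n) (at x)))) \<le> ereal (lip_a f x)"
      by (rule limsup_le_lip_a[OF assms(5) r0])
  qed
  have "E \<in> sets borel" unfolding K(3) using compact_imp_closed[OF K(1)] by auto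
  then have "UNIV - E \<in> sets \<mu>" using assms(2) by auto
  then have "AE x in \<mu>. (\<lambda>n. F n x) \<longlonglongrightarrow> f x \<and>
       limsup (\<lambda>n. ereal (onorm (frechet_derivative (F n) (at x)))) \<le> ereal (lip_a f x)"
    using conv by (intro AE_I[of _ _ "UNIV - E"] assms(4)) auto
  moreover have "(SUP n. ereal (Lip (F n) UNIV)) \<le> ereal (Lip f UNIV + \<epsilon>)"
    by (rule SUP_least) (simp add: Lip_le[OF lip])
  ultimately show ?thesis using Cyl bounds by blast
qed

end
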